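(* Let $\mathbb F$ be a field of characteristic zero and let $n\geq 1$. Let $H_n(t)=\sum_{k\geq 0}\dim Z_{n,k}\,t^k$ be the Hilbert series of the center $Z_n$ of the universal enveloping algebra of the standard filiform Lie algebra $\mathfrak g(n+2)$ over $\mathbb F$. Then $$H_n(t)=\frac{1}{2\pi}\int_{-\pi}^{\pi}\frac{1+\exp(i\varphi)}{\prod_{k=0}^n\bigl(1-t\exp(i(n-2k)\varphi)\bigr)}\,d\varphi .$$
   Context: The standard filiform Lie algebra $\mathfrak g(n+2)$ over $\mathbb F$ has basis $x,y_0,y_1,\ldots,y_n$ and nonzero brackets $[x,y_i]=y_{i-1}$ for $1\leq i\leq n$. By the Poincaré–Birkhoff–Witt Theorem the polynomial algebra $\mathbb F[y_0,\ldots,y_n]$ is a subalgebra of $U(\mathfrak g(n+2))$. In characteristic zero, $Z_n$, the center of $U(\mathfrak g(n+2))$, is viewed as a graded subalgebra (with respect to polynomial degree) of $\mathbb F[y_0,\ldots,y_n]$, namely the set of $f$ with $\sum_{i=0}^{n-1}y_i\,\partial f/\partial y_{i+1}=0$; $Z_{n,k}$ is its degree-$k$ homogeneous component. In the integral, $i$ is the imaginary unit. The identity is one of power series in $t$: the integrand is expanded as a power series in $t$ whose coefficients are functions of $\varphi$, and these are integrated coefficientwise. *)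

theory Defs
  imports
    "HOL-Analysis.Analysis"
    "HOL-Computational_Algebra.Formal_Power_Series"
    "HOL-Library.Poly_Mapping"
    "HOL-Algebra.QuotRing"
    "HOL-Algebra.Embedded_Algebras"
begin

section \<open>Universal enveloping algebras\<close>

text \<open>
  Words under concatenation, written additively because the convolution product on
  \<^typ>\<open>'k \<Rightarrow>\<^sub>0 'a\<close> takes its exponents from a (not necessarily commutative) additive
  monoid. Thus \<open>'b list \<Rightarrow>\<^sub>0 'a\<close> is the ring of noncommutative polynomials in letters \<open>'b\<close>.
\<close>

instantiation list :: (type) monoid_add
begin

definition zero_list :: "'a list" where "zero_list = []"

definition plus_list :: "'a list \<Rightarrow> 'a list \<Rightarrow> 'a list" where "plus_list = (@)"

instance by standard (simp_all add: zero_list_def plus_list_def)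

end

text \<open>
  The vector space with basis \<open>B\<close> consists of the finitely supported coefficient functions
  on \<open>B\<close>; its tensor algebra is the algebra of noncommutative polynomials in the letters \<open>B\<close>.
\<close>

definition vectors :: "'b set \<Rightarrow> ('b \<Rightarrow>\<^sub>0 'a::zero) set" where
  "vectors B = {u. Poly_Mapping.keys u \<subseteq> B}"

definition tensor_algebra :: "'b set \<Rightarrow> ('b list \<Rightarrow>\<^sub>0 'a::field) ring" where
  "tensor_algebra B =
    \<lparr>carrier = {p. Poly_Mapping.keys p \<subseteq> lists B}, mult = (*), one = 1, zero = 0, add = (+)\<rparr>"

definition tensor :: "('b \<Rightarrow>\<^sub>0 'a) \<Rightarrow> ('b list \<Rightarrow>\<^sub>0 'a::field)" where
  "tensor u = (\<Sum>b\<in>Poly_Mapping.keys u. Poly_Mapping.single [b] (Poly_Mapping.lookup u b))"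

definition bilinear_extension ::
  "('b \<Rightarrow> 'b \<Rightarrow> ('b \<Rightarrow>\<^sub>0 'a)) \<Rightarrow> ('b \<Rightarrow>\<^sub>0 'a) \<Rightarrow> ('b \<Rightarrow>\<^sub>0 'a) \<Rightarrow> ('b \<Rightarrow>\<^sub>0 'a::field)" where
  "bilinear_extension br u v =
    (\<Sum>b\<in>Poly_Mapping.keys u. \<Sum>c\<in>Poly_Mapping.keys v.
      Poly_Mapping.map ((*) (Poly_Mapping.lookup u b * Poly_Mapping.lookup v c)) (br b c))"

text \<open>
  Below, \<open>br b c\<close> is the bracket of two basis elements, and
  \<open>U(g) = T(g) / (u \<otimes> v - v \<otimes> u - [u,v] | u, v \<in> g)\<close>.
\<close>

definition enveloping_ideal ::
  "'b set \<Rightarrow> ('b \<Rightarrow> 'b \<Rightarrow> ('b \<Rightarrow>\<^sub>0 'a::field)) \<Rightarrow> ('b list \<Rightarrow>\<^sub>0 'a) set" where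
  "enveloping_ideal B br =
    Idl\<^bsub>tensor_algebra B\<^esub>
      {tensor u * tensor v - tensor v * tensor u - tensor (bilinear_extension br u v) | u v.
        u \<in> vectors B \<and> v \<in> vectors B}"

definition enveloping_algebra ::
  "'b set \<Rightarrow> ('b \<Rightarrow> 'b \<Rightarrow> ('b \<Rightarrow>\<^sub>0 'a::field)) \<Rightarrow> ('b list \<Rightarrow>\<^sub>0 'a) set ring" where
  "enveloping_algebra B br = tensor_algebra B Quot enveloping_ideal B br"

definition enveloping_class ::
  "'b set \<Rightarrow> ('b \<Rightarrow> 'b \<Rightarrow> ('b \<Rightarrow>\<^sub>0 'a::field)) \<Rightarrow> ('b list \<Rightarrow>\<^sub>0 'a) \<Rightarrow> ('b list \<Rightarrow>\<^sub>0 'a) set" where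
  "enveloping_class B br p = enveloping_ideal B br +>\<^bsub>tensor_algebra B\<^esub> p"

definition enveloping_scalars ::
  "'b set \<Rightarrow> ('b \<Rightarrow> 'b \<Rightarrow> ('b \<Rightarrow>\<^sub>0 'a::field)) \<Rightarrow> ('b list \<Rightarrow>\<^sub>0 'a) set set" where
  "enveloping_scalars B br = range (\<lambda>c. enveloping_class B br (Poly_Mapping.single [] c))"

definition ring_center :: "('r, 'm) ring_scheme \<Rightarrow> 'r set" where
  "ring_center R = {z \<in> carrier R. \<forall>w\<in>carrier R. z \<otimes>\<^bsub>R\<^esub> w = w \<otimes>\<^bsub>R\<^esub> z}"


section \<open>The standard filiform Lie algebra\<close>

datatype filiform_gen = Bx | By nat

definition filiform_basis :: "nat \<Rightarrow> filiform_gen set" where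
  "filiform_basis n = insert Bx (By ` {0..n})"

fun filiform_bracket :: "filiform_gen \<Rightarrow> filiform_gen \<Rightarrow> (filiform_gen \<Rightarrow>\<^sub>0 'a::field)" where
  "filiform_bracket Bx (By (Suc i)) = Poly_Mapping.single (By i) 1"
| "filiform_bracket (By (Suc i)) Bx = - Poly_Mapping.single (By i) 1"
| "filiform_bracket _ _ = 0"

abbreviation filiform_U :: "nat \<Rightarrow> (filiform_gen list \<Rightarrow>\<^sub>0 'a::field) set ring" where
  "filiform_U n \<equiv> enveloping_algebra (filiform_basis n) filiform_bracket"

text \<open>
  The degree \<open>k\<close> component of the subalgebra \<open>F[y\<^sub>0,\<dots>,y\<^sub>n]\<close> of \<open>U(g(n+2))\<close>: linear
  combinations of products of \<open>k\<close> of the \<open>y\<^sub>i\<close>. The order of the factors is immaterial, as the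
  \<open>y\<^sub>i\<close> commute in \<open>U(g(n+2))\<close>.
\<close>

definition y_polys :: "nat \<Rightarrow> nat \<Rightarrow> (filiform_gen list \<Rightarrow>\<^sub>0 'a::field) set set" where
  "y_polys n k =
    enveloping_class (filiform_basis n) filiform_bracket `
      {p. Poly_Mapping.keys p \<subseteq> {w \<in> lists (By ` {0..n}). length w = k}}"

text \<open>
  In characteristic zero and for \<open>n \<ge> 1\<close> the whole center lies in \<open>F[y\<^sub>0,\<dots>,y\<^sub>n]\<close> and is a
  graded subalgebra of it, so it is the direct sum of the following components.
\<close>

definition center_component :: "nat \<Rightarrow> nat \<Rightarrow> (filiform_gen list \<Rightarrow>\<^sub>0 'a::field) set set" where
  "center_component n k = ring_center (filiform_U n) \<inter> y_polys n k"

definition hilbert_series_center :: "'a::field_char_0 itself \<Rightarrow> nat \<Rightarrow> complex fps" where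
  "hilbert_series_center _ n =
    Abs_fps (\<lambda>k. of_nat
      (ring.dim (filiform_U n) (enveloping_scalars (filiform_basis n) filiform_bracket)
        (center_component n k :: (filiform_gen list \<Rightarrow>\<^sub>0 'a) set set)))"


section \<open>Coefficientwise integration\<close>

definition fps_coeff_integral :: "real \<Rightarrow> real \<Rightarrow> (real \<Rightarrow> complex fps) \<Rightarrow> complex fps" where
  "fps_coeff_integral a b F = Abs_fps (\<lambda>m. integral {a..b} (\<lambda>\<phi>. fps_nth (F \<phi>) m))"

end

theory Submission
  imports Defs
begin

text \<open>
  Let \<open>x\<close> act on \<open>F[y\<^sub>0,\<dots>,y\<^sub>n]\<close> as the derivation \<open>D\<close> with \<open>D y\<^sub>i = y\<^sub>i\<^sub>-\<^sub>1\<close>, \<open>D y\<^sub>0 = 0\<close>, and let \<open>y\<^sub>i\<close> act by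
  multiplication. This is a module over the enveloping algebra, and it separates the commutative
  polynomials in the \<open>y\<^sub>i\<close> (apply them to \<open>1\<close>), which replaces the Poincare-Birkhoff-Witt Theorem.
  Such a polynomial is central iff \<open>D\<close> kills it. Together with the derivation
  \<open>y\<^sub>i \<mapsto> (i + 1) (n - i) y\<^sub>i\<^sub>+\<^sub>1\<close>, the operator \<open>D\<close> spans a copy of \<open>sl\<^sub>2\<close> in which the weight of
  \<open>y\<^sub>i\<close> is \<open>n - 2 i\<close> and \<open>D\<close> raises weights by 2. Hence \<open>D\<close> is injective on negative weights and
  maps the weights \<open>\<ge> -1\<close> onto the weights \<open>\<ge> 1\<close>, so the dimension of its kernel in degree \<open>k\<close> is
  the number of monomials of weight \<open>0\<close> or \<open>-1\<close>. The integral extracts the same number from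
  the generating function of the weights of all monomials.
\<close>

section \<open>Finitely supported functions as a vector space\<close>

definition pscale :: "'a::field \<Rightarrow> ('b \<Rightarrow>\<^sub>0 'a) \<Rightarrow> ('b \<Rightarrow>\<^sub>0 'a)" where
  "pscale c = Poly_Mapping.map ((*) c)"

lemma lookup_pscale [simp]: "Poly_Mapping.lookup (pscale c p) k = c * Poly_Mapping.lookup p k"
  by (simp add: pscale_def Poly_Mapping.map.rep_eq when_def)

global_interpretation pm: vector_space "pscale :: 'a::field \<Rightarrow> ('b \<Rightarrow>\<^sub>0 'a) \<Rightarrow> _"
  by unfold_locales (auto intro!: poly_mapping_eqI simp: lookup_add algebra_simps)

global_interpretation pm_pair: vector_space_pair
  "pscale :: 'a::field \<Rightarrow> ('b \<Rightarrow>\<^sub>0 'a) \<Rightarrow> _" "pscale :: 'a::field \<Rightarrow> ('c \<Rightarrow>\<^sub>0 'a) \<Rightarrow> _"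
  by unfold_locales

lemma pscale_conv_mult: "pscale c p = Poly_Mapping.single 0 c * (p :: 'b::monoid_add \<Rightarrow>\<^sub>0 _)"
  by (simp add: pscale_def mult_map_scale_conv_mult)

lemma pscale_single [simp]: "pscale c (Poly_Mapping.single b d) = Poly_Mapping.single b (c * d)"
  by (rule poly_mapping_eqI) (simp add: lookup_single when_def)

lemma poly_mapping_sum_singles:
  "p = (\<Sum>b\<in>Poly_Mapping.keys p. Poly_Mapping.single b (Poly_Mapping.lookup p b))"
proof (rule poly_mapping_eqI)
  fix k
  have "(\<Sum>b\<in>Poly_Mapping.keys p. Poly_Mapping.lookup p b when b = k) =
        (\<Sum>b\<in>Poly_Mapping.keys p. if b = k then Poly_Mapping.lookup p k else 0)"
    by (intro sum.cong) (auto simp: when_def)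
  then show "Poly_Mapping.lookup p k =
      Poly_Mapping.lookup (\<Sum>b\<in>Poly_Mapping.keys p. Poly_Mapping.single b (Poly_Mapping.lookup p b)) k"
    by (simp add: lookup_sum lookup_single sum.delta in_keys_iff)
qed

lemma pscale_mult_left: "pscale c p * q = pscale c (p * q)"
  for p q :: "'b::monoid_add \<Rightarrow>\<^sub>0 'a::field"
  by (simp add: pscale_conv_mult mult.assoc)

text \<open>The constants sit at the neutral exponent, so they are central even when the monoid of
  exponents is not commutative.\<close>

lemma pscale_mult_right: "p * pscale c q = pscale c (p * q)"
  for p q :: "'b::monoid_add \<Rightarrow>\<^sub>0 'a::field"
proof -
  have "p * Poly_Mapping.single 0 c = Poly_Mapping.single 0 c * p"
    by (subst (1 2) poly_mapping_sum_singles[of p])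
      (simp add: sum_distrib_left sum_distrib_right mult_single mult.commute)
  then show ?thesis
    by (simp add: pscale_conv_mult flip: mult.assoc)
qed

section \<open>Coordinate subspaces and their bases\<close>

lemma vectorsI: "Poly_Mapping.keys p \<subseteq> A \<Longrightarrow> p \<in> vectors A"
  by (simp add: vectors_def)

lemma in_vectors_iff: "p \<in> vectors A \<longleftrightarrow> (\<forall>b. b \<notin> A \<longrightarrow> Poly_Mapping.lookup p b = 0)"
  by (auto simp: vectors_def subset_iff in_keys_iff)

lemma zero_in_vectors [simp]: "0 \<in> vectors A"
  by (simp add: vectors_def)

lemma single_in_vectors: "b \<in> A \<Longrightarrow> Poly_Mapping.single b c \<in> vectors A"
  by (simp add: vectors_def)

lemma subspace_vectors: "pm.subspace (vectors A)"
  by (rule pm.subspaceI) (auto simp: in_vectors_iff lookup_add)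

lemma vectors_eq_span:
  "vectors A = pm.span ((\<lambda>b. Poly_Mapping.single b (1::'a::field)) ` A)"
proof
  show "pm.span ((\<lambda>b. Poly_Mapping.single b (1::'a)) ` A) \<subseteq> vectors A"
    by (intro pm.span_minimal subspace_vectors) (auto intro: single_in_vectors)
  show "vectors A \<subseteq> pm.span ((\<lambda>b. Poly_Mapping.single b (1::'a)) ` A)"
  proof
    fix p :: "_ \<Rightarrow>\<^sub>0 'a" assume p: "p \<in> vectors A"
    have "(\<Sum>b\<in>Poly_Mapping.keys p. pscale (Poly_Mapping.lookup p b) (Poly_Mapping.single b 1)) \<in>
        pm.span ((\<lambda>b. Poly_Mapping.single b (1::'a)) ` A)"
      using p by (intro pm.span_sum pm.span_scale pm.span_base) (auto simp: vectors_def)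
    then show "p \<in> pm.span ((\<lambda>b. Poly_Mapping.single b (1::'a)) ` A)"
      using poly_mapping_sum_singles[of p] by simp
  qed
qed

lemma inj_single_one: "inj (\<lambda>b. Poly_Mapping.single b (1::'a::zero_neq_one))"
proof (rule injI)
  fix b c assume "Poly_Mapping.single b (1::'a) = Poly_Mapping.single c 1"
  then have "Poly_Mapping.keys (Poly_Mapping.single b (1::'a)) =
      Poly_Mapping.keys (Poly_Mapping.single c (1::'a))" by simp
  then show "b = c" by simp
qed

text \<open>The remaining singles span \<open>vectors (A - {b})\<close>, and every element of that
  space has coefficient 0 at \<open>b\<close>.\<close>

lemma independent_singles:
  "pm.independent ((\<lambda>b. Poly_Mapping.single b (1::'a::field)) ` A)"
proof -
  have "Poly_Mapping.single b (1::'a) \<notin> pm.span ((\<lambda>b. Poly_Mapping.single b 1) ` A - {Poly_Mapping.single b 1})" for b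
  proof -
    have "(\<lambda>b. Poly_Mapping.single b (1::'a)) ` A - {Poly_Mapping.single b 1} =
        (\<lambda>b. Poly_Mapping.single b 1) ` (A - {b})"
      using inj_single_one[where 'a = 'a] by (auto simp: inj_def)
    moreover have "Poly_Mapping.single b (1::'a) \<notin> vectors (A - {b})"
      by (simp add: vectors_def)
    ultimately show ?thesis
      by (simp add: vectors_eq_span)
  qed
  then show ?thesis
    by (auto simp: pm.dependent_def)
qed

lemma dim_vectors: "finite A \<Longrightarrow> pm.dim (vectors A :: ('b \<Rightarrow>\<^sub>0 'a::field) set) = card A"
  unfolding vectors_eq_span pm.dim_span
  by (subst pm.dim_eq_card_independent[OF independent_singles])
    (rule card_image[OF inj_on_subset[OF inj_single_one subset_UNIV]])

section \<open>Linear maps given on a basis; rank and nullity\<close>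

lemma linear_pscaleI:
  assumes "\<And>p q. f (p + q) = f p + f q" "\<And>c p. f (pscale c p) = pscale c (f p)"
  shows "Vector_Spaces.linear pscale pscale f"
  using assms by (simp add: Vector_Spaces.linear_iff pm.vector_space_axioms)

text \<open>Agreement is required only on the support of \<open>p\<close>, so that a support
  condition on \<open>p\<close> can enter the comparison, as in
  \<open>sl2_weight_monomials\<close>.\<close>

lemma linear_eqI:
  assumes "Vector_Spaces.linear pscale pscale f" "Vector_Spaces.linear pscale pscale g"
    and "\<And>b. b \<in> Poly_Mapping.keys p \<Longrightarrow> f (Poly_Mapping.single b 1) = g (Poly_Mapping.single b 1)"
  shows "f p = g p"
  by (rule pm_pair.linear_eq_on[OF assms(1,2), of _ "(\<lambda>b. Poly_Mapping.single b 1) ` Poly_Mapping.keys p"])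
    (use assms(3) in \<open>auto simp flip: vectors_eq_span intro: vectorsI\<close>)

text \<open>The linear extension of \<open>g\<close> from the basis of singles. Derivations,
  projections, the module action and \<open>tensor\<close> are all written with it, so that their
  linearity is proved once.\<close>

definition lin :: "('b \<Rightarrow> ('c \<Rightarrow>\<^sub>0 'a)) \<Rightarrow> ('b \<Rightarrow>\<^sub>0 'a::field) \<Rightarrow> ('c \<Rightarrow>\<^sub>0 'a)" where
  "lin g p = (\<Sum>b\<in>Poly_Mapping.keys p. pscale (Poly_Mapping.lookup p b) (g b))"

lemma lin_superset:
  assumes "finite A" "Poly_Mapping.keys p \<subseteq> A"
  shows "lin g p = (\<Sum>b\<in>A. pscale (Poly_Mapping.lookup p b) (g b))"
  unfolding lin_def using assms
  by (intro sum.mono_neutral_left) (auto simp: in_keys_iff)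

lemma linear_lin: "Vector_Spaces.linear pscale pscale (lin g)"
  for g :: "'b \<Rightarrow> ('c \<Rightarrow>\<^sub>0 'a::field)"
proof (rule linear_pscaleI)
  fix p q :: "'b \<Rightarrow>\<^sub>0 'a"
  let ?A = "Poly_Mapping.keys p \<union> Poly_Mapping.keys q"
  have "lin g (p + q) = (\<Sum>b\<in>?A. pscale (Poly_Mapping.lookup (p + q) b) (g b))"
    by (rule lin_superset) (simp_all add: keys_add)
  also have "\<dots> = (\<Sum>b\<in>?A. pscale (Poly_Mapping.lookup p b) (g b)) + (\<Sum>b\<in>?A. pscale (Poly_Mapping.lookup q b) (g b))"
    by (simp add: lookup_add pm.scale_left_distrib sum.distrib)
  also have "\<dots> = lin g p + lin g q"
    by (simp add: lin_superset[of ?A])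
  finally show "lin g (p + q) = lin g p + lin g q" .
next
  fix c and p :: "'b \<Rightarrow>\<^sub>0 'a"
  have "lin g (pscale c p) = (\<Sum>b\<in>Poly_Mapping.keys p. pscale (Poly_Mapping.lookup (pscale c p) b) (g b))"
    by (rule lin_superset) (auto simp: in_keys_iff)
  then show "lin g (pscale c p) = pscale c (lin g p)"
    by (simp add: lin_def pm.scale_sum_right)
qed

lemma lin_single [simp]: "lin g (Poly_Mapping.single b c) = pscale c (g b)"
  by (cases "c = 0") (auto simp: lin_def)

lemmas lin_scale = pm_pair.linear_scale[OF linear_lin]
  and lin_sum = pm_pair.linear_sum[OF linear_lin]
  and lin_zero [simp] = pm_pair.linear_0[OF linear_lin]
  and lin_uminus = pm_pair.linear_neg[OF linear_lin]

lemma linear_in_subspace: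
  assumes "Vector_Spaces.linear pscale pscale f" "pm.subspace V"
    "\<And>b. b \<in> Poly_Mapping.keys p \<Longrightarrow> f (Poly_Mapping.single b 1) \<in> V"
  shows "f p \<in> V"
proof -
  have "f p = (\<Sum>b\<in>Poly_Mapping.keys p. pscale (Poly_Mapping.lookup p b) (f (Poly_Mapping.single b 1)))"
    by (subst poly_mapping_sum_singles[of p])
      (simp add: pm_pair.linear_sum[OF assms(1)] flip: pm_pair.linear_scale[OF assms(1)])
  also have "\<dots> \<in> V"
    by (intro pm.subspace_sum pm.subspace_scale assms)
  finally show ?thesis .
qed

text \<open>Only \<open>V\<close> has to be finite-dimensional, not the ambient space. A basis
  \<open>B\<close> of the kernel extends to a basis \<open>C\<close> of \<open>V\<close>, and
  \<open>f\<close> maps \<open>C - B\<close> bijectively onto a basis of the image.\<close>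

lemma (in vector_space_pair) dim_kernel_image:
  assumes lin: "Vector_Spaces.linear s1 s2 f" and V: "vs1.subspace V" and fin: "finite A" "V \<subseteq> vs1.span A"
  shows "vs1.dim V = vs1.dim {v \<in> V. f v = 0} + vs2.dim (f ` V)"
proof -
  let ?K = "{v \<in> V. f v = 0}"
  interpret f: Vector_Spaces.linear s1 s2 f by fact
  obtain B where B: "B \<subseteq> ?K" "vs1.independent B" "?K \<subseteq> vs1.span B"
    by (rule vs1.maximal_independent_subset)
  have "B \<subseteq> V" using B by auto
  then obtain C where C: "B \<subseteq> C" "C \<subseteq> V" "vs1.independent C" "V \<subseteq> vs1.span C"
    by (rule vs1.maximal_independent_subset_extend[OF _ B(2)])
  have "finite C"
    using vs1.independent_span_bound[OF fin(1) C(3)] C(2) fin(2) by auto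
  have indCB: "vs1.independent (C - B)"
    using C(3) by (rule vs1.independent_mono) auto
  have inj: "inj_on f (vs1.span (C - B))"
  proof (subst f.inj_on_iff_eq_0[OF vs1.subspace_span], intro ballI impI)
    fix v assume v: "v \<in> vs1.span (C - B)" "f v = 0"
    have "v \<in> V"
      using v(1) vs1.span_minimal[OF _ V, of "C - B"] C(2) by blast
    with v B have "v \<in> vs1.span B" by auto
    \<comment> \<open>Both representations agree with the one over \<open>C\<close>; their supports
      lie in the disjoint sets \<open>B\<close> and \<open>C - B\<close>, so they vanish.\<close>
    then have "vs1.representation B v = vs1.representation (C - B) v"
      using vs1.representation_extend[OF C(3) _ C(1)] vs1.representation_extend[OF C(3) v(1)] by simp
    then have "vs1.representation B v = (\<lambda>_. 0)"
      using vs1.representation_ne_zero[of B v] vs1.representation_ne_zero[of "C - B" v] by (metis DiffD2)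
    then show "v = 0"
      using vs1.sum_nonzero_representation_eq[OF B(2) \<open>v \<in> vs1.span B\<close>] by simp
  qed
  have ind: "vs2.independent (f ` (C - B))"
    by (rule f.independent_injective_image[OF indCB inj])
  have "f ` V \<subseteq> vs2.span (f ` (C - B))"
  proof -
    have "f ` V \<subseteq> f ` vs1.span C" using C(4) by auto
    also have "\<dots> = vs2.span (f ` C)" by (simp add: f.span_image)
    also have "\<dots> \<subseteq> vs2.span (f ` (C - B))"
    proof (rule vs2.span_minimal)
      show "f ` C \<subseteq> vs2.span (f ` (C - B))"
        using B(1) vs2.span_base[of _ "f ` (C - B)"] vs2.span_zero by fastforce
    qed (rule vs2.subspace_span)
    finally show ?thesis .
  qed
  then have "vs2.dim (f ` V) = card (f ` (C - B))"
    using ind C(2) by (intro vs2.basis_card_eq_dim[symmetric]) auto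
  also have "\<dots> = card (C - B)"
    using inj vs1.span_superset by (intro card_image) (rule inj_on_subset)
  finally have "vs2.dim (f ` V) = card (C - B)" .
  moreover have "vs1.dim ?K = card B"
    using B by (intro vs1.basis_card_eq_dim[symmetric])
  moreover have "vs1.dim V = card C"
    using C by (intro vs1.basis_card_eq_dim[symmetric])
  ultimately show ?thesis
    using \<open>finite C\<close> C(1) by (simp add: card_Diff_subset finite_subset card_mono)
qed

section \<open>Representations of sl2\<close>

text \<open>The element h of sl2 is present only as the weight \<open>w\<close> in the commutator
  relation. The bound \<open>N\<close> on the weights stands in for finite dimension: it makes
  \<open>e\<close> and \<open>f\<close> nilpotent on each weight vector.\<close>

locale sl2_weight_spaces =
  fixes e f :: "('b \<Rightarrow>\<^sub>0 'a::field_char_0) \<Rightarrow> ('b \<Rightarrow>\<^sub>0 'a)" and V :: "int \<Rightarrow> ('b \<Rightarrow>\<^sub>0 'a) set" and N :: int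
  assumes linear_e: "Vector_Spaces.linear pscale pscale e"
    and linear_f: "Vector_Spaces.linear pscale pscale f"
    and subspace_V: "pm.subspace (V w)"
    and e_weight: "v \<in> V w \<Longrightarrow> e v \<in> V (w + 2)"
    and f_weight: "v \<in> V w \<Longrightarrow> f v \<in> V (w - 2)"
    and commutator: "v \<in> V w \<Longrightarrow> e (f v) - f (e v) = pscale (of_int w) v"
    and weight_bound: "v \<in> V w \<Longrightarrow> N < \<bar>w\<bar> \<Longrightarrow> v = 0"
begin

text \<open>The symmetry of sl2 that exchanges \<open>e\<close> and \<open>f\<close> and negates
  weights; it turns results about \<open>e\<close> into results about \<open>f\<close>.\<close>

lemma swap: "sl2_weight_spaces f e (\<lambda>w. V (- w)) N"
proof (rule sl2_weight_spaces.intro)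
  show "f (e v) - e (f v) = pscale (of_int w) v" if "v \<in> V (- w)" for v w
    using commutator[OF that] by (simp add: algebra_simps)
  show "f v \<in> V (- (w + 2))" if "v \<in> V (- w)" for v w
    using f_weight[OF that] by (simp add: algebra_simps)
  show "e v \<in> V (- (w - 2))" if "v \<in> V (- w)" for v w
    using e_weight[OF that] by (simp add: algebra_simps)
  show "v = 0" if "v \<in> V (- w)" "N < \<bar>w\<bar>" for v w
    using weight_bound[OF that(1)] that(2) by simp
qed (rule linear_e linear_f subspace_V)+

lemma e_pow_weight: "v \<in> V w \<Longrightarrow> (e ^^ j) v \<in> V (w + 2 * int j)"
proof (induction j)
  case (Suc j)
  then show ?case using e_weight[of "(e ^^ j) v" "w + 2 * int j"] by (simp add: algebra_simps)
qed simp

lemma e_nilpotent: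
  assumes "v \<in> V w"
  obtains j where "(e ^^ j) v = 0"
proof
  \<comment> \<open>After this many steps the weight exceeds \<open>N\<close>, whatever the signs of
    \<open>N\<close> and \<open>w\<close>.\<close>
  show "(e ^^ nat (\<bar>N\<bar> + \<bar>w\<bar> + 1)) v = 0"
    by (rule weight_bound[OF e_pow_weight[OF assms]]) auto
qed

lemma e_pow_zero [simp]: "(e ^^ j) 0 = 0"
  by (induction j) (auto simp: pm_pair.linear_0[OF linear_e])

text \<open>Each time \<open>f\<close> moves past one \<open>e\<close> it leaves h; these act by the
  weights \<open>w\<close>, \<open>w + 2\<close>, ..., \<open>w + 2 j\<close>, whose sum is
  \<open>(j + 1) (w + j)\<close>.\<close>

lemma e_pow_f:
  assumes "v \<in> V w"
  shows "(e ^^ Suc j) (f v) =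
    f ((e ^^ Suc j) v) + pscale (of_int ((int j + 1) * (w + int j))) ((e ^^ j) v)"
proof (induction j)
  case 0
  then show ?case using commutator[OF assms] by (simp add: algebra_simps)
next
  case (Suc j)
  let ?u = "(e ^^ Suc j) v"
  have "(e ^^ Suc (Suc j)) (f v) = e (f ?u) + pscale (of_int ((int j + 1) * (w + int j))) ?u"
    by (subst funpow.simps(2), subst o_apply, subst Suc.IH)
      (simp add: pm_pair.linear_add[OF linear_e] pm_pair.linear_scale[OF linear_e])
  also have "e (f ?u) = f (e ?u) + pscale (of_int (w + 2 * int (Suc j))) ?u"
    using commutator[OF e_pow_weight[OF assms, of "Suc j"]] by (simp add: algebra_simps)
  also have "\<dots> + pscale (of_int ((int j + 1) * (w + int j))) ?u =
      f (e ?u) + pscale (of_int (w + 2 * int (Suc j) + (int j + 1) * (w + int j))) ?u"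
    by (simp only: of_int_add pm.scale_left_distrib add.assoc)
  also have "w + 2 * int (Suc j) + (int j + 1) * (w + int j) = (int (Suc j) + 1) * (w + int (Suc j))"
    by (simp add: algebra_simps)
  finally show ?case by simp
qed

text \<open>
  On the vectors \<open>v\<close> of weight \<open>w\<close> with \<open>e\<^bsup>j + 1\<^esup> v = 0\<close>, the operator \<open>e f - (j + 1) (w + j)\<close>
  takes values in the kernel of \<open>e\<^bsup>j\<^esup>\<close>; as \<open>(j + 1) (w + j)\<close> is nonzero, induction on \<open>j\<close> solves for \<open>v\<close>.
\<close>

lemma e_surj:
  assumes "v \<in> V w" "w > 0"
  shows "\<exists>u\<in>V (w - 2). e u = v"
proof -
  have "(e ^^ j) v = 0 \<Longrightarrow> v \<in> V w \<Longrightarrow> \<exists>u\<in>V (w - 2). e u = v" for j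
  proof (induction j arbitrary: v)
    case 0
    then show ?case
      using pm.subspace_0[OF subspace_V] pm_pair.linear_0[OF linear_e] by auto
  next
    case (Suc j)
    define c :: 'a where "c = of_int ((int j + 1) * (w + int j))"
    have "c \<noteq> 0" using \<open>w > 0\<close> by (simp add: c_def del: of_int_mult of_int_add)
    have lin: "Vector_Spaces.linear pscale pscale (e ^^ j)" 
      by (induction j)
        (simp_all add: pm.linear_id[unfolded id_def] Vector_Spaces.linear_compose[OF _ linear_e] del: o_apply)
    have "(e ^^ j) (e (f v) - pscale c v) = (e ^^ Suc j) (f v) - pscale c ((e ^^ j) v)"
      by (simp add: pm_pair.linear_diff[OF lin] pm_pair.linear_scale[OF lin] funpow_swap1)
    also have "\<dots> = 0"
      unfolding e_pow_f[OF Suc.prems(2)] Suc.prems(1)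
      by (simp add: c_def pm_pair.linear_0[OF linear_f])
    finally have "(e ^^ j) (e (f v) - pscale c v) = 0" .
    moreover have "e (f v) - pscale c v \<in> V w"
      using e_weight[OF f_weight[OF Suc.prems(2)]] Suc.prems(2)
      by (intro pm.subspace_diff pm.subspace_scale subspace_V) simp_all
    ultimately obtain z where z: "z \<in> V (w - 2)" "e z = e (f v) - pscale c v"
      using Suc.IH by blast
    show ?case
    proof
      \<comment> \<open>Since \<open>e z\<close> is \<open>e (f v)\<close> minus \<open>c\<close>
        times \<open>v\<close>, the vector \<open>f v - z\<close> is mapped to \<open>c\<close>
        times \<open>v\<close>.\<close>
      show "pscale (1 / c) (f v - z) \<in> V (w - 2)"
        using z f_weight[OF Suc.prems(2)] by (intro pm.subspace_diff pm.subspace_scale subspace_V)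
      show "e (pscale (1 / c) (f v - z)) = v"
        using z(2) \<open>c \<noteq> 0\<close> by (simp add: pm_pair.linear_diff[OF linear_e] pm_pair.linear_scale[OF linear_e])
    qed
  qed
  then show ?thesis
    using e_nilpotent[OF assms(1)] assms(1) by blast
qed

text \<open>In the mirrored form of \<open>e_pow_f\<close> the term with \<open>e v\<close> vanishes
  and the scalar \<open>(j + 1) (- w + j)\<close> is nonzero. So if a power of \<open>f\<close>
  kills \<open>v\<close>, the previous power does too, and \<open>f\<close> is nilpotent on
  \<open>v\<close>.\<close>

lemma e_inj:
  assumes v: "v \<in> V w" and "w < 0" "e v = 0"
  shows "v = 0"
proof -
  interpret sw: sl2_weight_spaces f e "\<lambda>w. V (- w)" N by (rule swap)
  have v': "v \<in> V (- (- w))" using v by simp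
  have "(f ^^ j) v = 0 \<Longrightarrow> v = 0" for j
  proof (induction j)
    case (Suc j)
    have "pscale (of_int ((int j + 1) * (- w + int j))) ((f ^^ j) v) = 0"
      using sw.e_pow_f[OF v', of j] Suc.prems \<open>e v = 0\<close>
      by (simp del: funpow.simps add: pm_pair.linear_0[OF linear_e])
    moreover have "of_int ((int j + 1) * (- w + int j)) \<noteq> (0::'a)"
      using \<open>w < 0\<close> by (simp del: of_int_mult of_int_add of_int_diff of_int_minus)
    ultimately show ?case using Suc.IH by (simp only: pm.scale_eq_0_iff) simp
  qed simp
  then show ?thesis
    using sw.e_nilpotent[OF v'] by blast
qed

end

section \<open>Derivations of the polynomial algebra\<close>

text \<open>
  Commutative polynomials in the variables \<open>y\<^sub>i\<close>, \<open>i \<in> \<nat>\<close>, are elements of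
  \<^typ>\<open>nat multiset \<Rightarrow>\<^sub>0 'a\<close>, a monomial being the multiset of its indices;
  \<open>shift_der t c\<close> is the derivation that maps \<open>y\<^sub>i\<close> to \<open>c i\<close> times \<open>y\<^bsub>t i\<^esub>\<close>.
\<close>

lemma subspace_sum_mset:
  "pm.subspace V \<Longrightarrow> (\<And>i. i \<in># M \<Longrightarrow> g i \<in> V) \<Longrightarrow> (\<Sum>i\<in>#M. g i) \<in> V"
  by (induction M) (auto intro: pm.subspace_0 pm.subspace_add)

lemma lin_one: "lin g 1 = g 0"
  using lin_single[of g 0 1] by (simp del: lin_single)

definition shift_der ::
  "(nat \<Rightarrow> nat) \<Rightarrow> (nat \<Rightarrow> 'a::field) \<Rightarrow> (nat multiset \<Rightarrow>\<^sub>0 'a) \<Rightarrow> (nat multiset \<Rightarrow>\<^sub>0 'a)" where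
  "shift_der t c = lin (\<lambda>M. \<Sum>i\<in>#M. Poly_Mapping.single (add_mset (t i) (M - {#i#})) (c i))"

lemma linear_shift_der: "Vector_Spaces.linear pscale pscale (shift_der t c)"
  unfolding shift_der_def by (rule linear_lin)

abbreviation pvar :: "nat \<Rightarrow> (nat multiset \<Rightarrow>\<^sub>0 'a::field)" where
  "pvar i \<equiv> Poly_Mapping.single {#i#} 1"

lemma linear_mult: "Vector_Spaces.linear pscale pscale ((*) (p :: 'b::monoid_add \<Rightarrow>\<^sub>0 'a::field))"
  by (rule linear_pscaleI) (simp_all add: distrib_left pscale_mult_right)

lemma pvar_mult_single: "pvar i * Poly_Mapping.single M c = Poly_Mapping.single (add_mset i M) c"
  by (simp add: mult_single)

text \<open>The Leibniz rule with a variable as first factor. With \<open>shift_der_one\<close> it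
  determines the derivation, since monomials are built one variable at a time.\<close>

lemma shift_der_pvar_mult:
  "shift_der t c (pvar i * p) = pscale (c i) (pvar (t i) * p) + pvar i * shift_der t c p"
proof (rule linear_eqI[where f = "\<lambda>p. shift_der t c (pvar i * p)"])
  show "Vector_Spaces.linear pscale pscale (\<lambda>p. shift_der t c (pvar i * p))"
    using Vector_Spaces.linear_compose[OF linear_mult linear_shift_der] by (simp add: o_def)
  show "Vector_Spaces.linear pscale pscale (\<lambda>p. pscale (c i) (pvar (t i) * p) + pvar i * shift_der t c p)"
    using linear_shift_der[of t c]
    by (intro linear_pscaleI)
      (simp_all add: distrib_left pm.scale_right_distrib pscale_mult_right pm_pair.linear_add
        pm_pair.linear_scale pm.scale_left_commute)
next
  fix M
  \<comment> \<open>These are the terms in which the derivation hits a variable of \<open>M\<close>;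
    the new factor y_i survives in each of them.\<close>
  have "(\<Sum>j\<in>#M. Poly_Mapping.single (add_mset (t j) (add_mset i M - {#j#})) (c j)) =
      (\<Sum>j\<in>#M. pvar i * Poly_Mapping.single (add_mset (t j) (M - {#j#})) (c j))"
    by (intro arg_cong[of _ _ sum_mset] image_mset_cong)
      (simp add: pvar_mult_single add_mset_commute)
  then show "shift_der t c (pvar i * Poly_Mapping.single M 1) =
      pscale (c i) (pvar (t i) * Poly_Mapping.single M 1) + pvar i * shift_der t c (Poly_Mapping.single M 1)"
    by (simp add: pvar_mult_single shift_der_def sum_mset_distrib_left)
qed

lemma shift_der_one [simp]: "shift_der t c 1 = 0"
  by (simp add: shift_der_def lin_one)

text \<open>Images are tested only for \<open>c i \<noteq> 0\<close>, as the other indices may lead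
  out of \<open>B\<close>: \<open>raise\<close> has coefficient 0 at y_0 and \<open>lower n\<close>
  at y_n.\<close>

lemma shift_der_in_vectors:
  assumes "p \<in> vectors A"
    "\<And>M i. M \<in> A \<Longrightarrow> i \<in># M \<Longrightarrow> c i \<noteq> 0 \<Longrightarrow> add_mset (t i) (M - {#i#}) \<in> B"
  shows "shift_der t c p \<in> vectors B"
proof (rule linear_in_subspace[OF linear_shift_der subspace_vectors])
  fix M assume "M \<in> Poly_Mapping.keys p"
  then have "M \<in> A" using assms(1) by (auto simp: vectors_def)
  have "Poly_Mapping.single (add_mset (t i) (M - {#i#})) (c i) \<in> vectors B" if "i \<in># M" for i
    using assms(2)[OF \<open>M \<in> A\<close> that]
    by (cases "c i = 0") (auto intro: single_in_vectors pm.subspace_0[OF subspace_vectors])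
  then show "shift_der t c (Poly_Mapping.single M 1) \<in> vectors B"
    by (auto simp: shift_der_def intro!: subspace_sum_mset[OF subspace_vectors])
qed

section \<open>The weight grading and the two sl2 operators on polynomials\<close>

definition weight :: "nat \<Rightarrow> nat multiset \<Rightarrow> int" where
  "weight n M = (\<Sum>i\<in>#M. int n - 2 * int i)"

lemma weight_simps [simp]:
  "weight n {#} = 0" "weight n (add_mset i M) = int n - 2 * int i + weight n M"
  by (simp_all add: weight_def)

lemma weight_shift:
  "i \<in># M \<Longrightarrow> weight n (add_mset j (M - {#i#})) = weight n M - 2 * int j + 2 * int i"
  by (auto dest!: multi_member_split)

lemma weight_bound: "set_mset M \<subseteq> {0..n} \<Longrightarrow> \<bar>weight n M\<bar> \<le> int (n * size M)"
proof (induction M)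
  case (add i M)
  then have "\<bar>int n - 2 * int i\<bar> \<le> int n" "\<bar>weight n M\<bar> \<le> int n * int (size M)" by auto
  then show ?case by (simp add: algebra_simps)
qed simp

text \<open>The derivation D, the sum of y_i d/dy_(i+1), known as the basic Weitzenboeck derivation.
  The coefficient at \<open>i = 0\<close> enforces D y_0 = 0, where truncated subtraction would give
  y_0.\<close>

definition raise :: "(nat multiset \<Rightarrow>\<^sub>0 'a::field) \<Rightarrow> (nat multiset \<Rightarrow>\<^sub>0 'a)" where
  "raise = shift_der (\<lambda>i. i - 1) (\<lambda>i. if i = 0 then 0 else 1)"

text \<open>The coefficients grow by n - 2 i from index i - 1 to i, which makes the commutator with
  \<open>raise\<close> multiply y_i by its weight; they vanish at i = n, so y_(n+1) is not reached.
  Integer arithmetic keeps the commutator identity valid for all indices.\<close>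

definition lower :: "nat \<Rightarrow> (nat multiset \<Rightarrow>\<^sub>0 'a::field) \<Rightarrow> (nat multiset \<Rightarrow>\<^sub>0 'a)" where
  "lower n = shift_der Suc (\<lambda>i. of_int ((int i + 1) * (int n - int i)))"

lemma linear_raise: "Vector_Spaces.linear pscale pscale raise"
  unfolding raise_def by (rule linear_shift_der)

lemma linear_lower: "Vector_Spaces.linear pscale pscale (lower n)"
  unfolding lower_def by (rule linear_shift_der)

lemma raise_pvar_mult:
  "raise (pvar 0 * p) = pvar 0 * raise p"
  "raise (pvar (Suc i) * p) = pvar i * p + pvar (Suc i) * raise p"
  by (simp_all add: raise_def shift_der_pvar_mult)

lemma lower_pvar_mult:
  "lower n (pvar i * p) =
    pscale (of_int ((int i + 1) * (int n - int i))) (pvar (Suc i) * p) + pvar i * lower n p"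
  unfolding lower_def by (rule shift_der_pvar_mult)

text \<open>The commutator of two derivations is again a derivation. Here \<open>q\<close> is its
  value at \<open>p\<close>, and its value at y_i is y_i times n - 2 i.\<close>

lemma raise_lower_commutator_pvar:
  assumes "raise (lower n p) = lower n (raise p) + q"
  shows "raise (lower n (pvar i * p)) =
    lower n (raise (pvar i * p)) + pscale (of_int (int n - 2 * int i)) (pvar i * p) + pvar i * q"
proof -
  note linear = pm_pair.linear_add[OF linear_raise] pm_pair.linear_scale[OF linear_raise]
    pm_pair.linear_add[OF linear_lower] pm_pair.linear_scale[OF linear_lower]
  define c :: "nat \<Rightarrow> int" where "c i = (int i + 1) * (int n - int i)" for i
  have lw: "lower n (pvar j * r) = pscale (of_int (c j)) (pvar (Suc j) * r) + pvar j * lower n r" for j r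
    unfolding c_def by (rule lower_pvar_mult)
  show ?thesis
  proof (cases i)
    case 0
    have "c 0 = int n - 2 * int 0" by (simp add: c_def)
    then show ?thesis unfolding 0
      by (simp only: lw raise_pvar_mult linear assms pm.scale_right_distrib distrib_left)
        (simp only: add_ac)
  next
    case (Suc j)
    have "c (Suc j) = c j + (int n - 2 * int (Suc j))" by (simp add: c_def algebra_simps)
    then have "pscale (of_int (c (Suc j))) r =
        pscale (of_int (c j)) r + pscale (of_int (int n - 2 * int (Suc j))) r"
      for r :: "nat multiset \<Rightarrow>\<^sub>0 'a"
      by (simp only: of_int_add pm.scale_left_distrib)
    then show ?thesis unfolding Suc
      by (simp only: lw raise_pvar_mult linear assms pm.scale_right_distrib distrib_left)
        (simp only: add_ac)
  qed
qed

lemma raise_lower_commutator: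
  "raise (lower n p) = lower n (raise p) + lin (\<lambda>M. Poly_Mapping.single M (of_int (weight n M))) p"
  (is "_ = _ + ?h p")
proof (rule linear_eqI[where f = "\<lambda>p. raise (lower n p)"])
  show "Vector_Spaces.linear pscale pscale (\<lambda>p. raise (lower n p))"
    "Vector_Spaces.linear pscale pscale (\<lambda>p. lower n (raise p) + ?h p)"
    using Vector_Spaces.linear_compose[OF linear_lower linear_raise]
      pm_pair.linear_compose_add[OF Vector_Spaces.linear_compose[OF linear_raise linear_lower] linear_lin]
    by (simp_all add: o_def)
next
  fix M
  show "raise (lower n (Poly_Mapping.single M 1)) =
      lower n (raise (Poly_Mapping.single M 1)) + ?h (Poly_Mapping.single M 1)"
  proof (induction M)
    case empty
    show ?case by (simp add: raise_def lower_def lin_one pm_pair.linear_0[OF linear_shift_der])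
  next
    case (add i M)
    from raise_lower_commutator_pvar[OF add, of i] show ?case
      by (simp add: pvar_mult_single single_add add.assoc)
  qed
qed

section \<open>Weight components and the dimension of the kernel\<close>

definition pm_restrict :: "'b set \<Rightarrow> ('b \<Rightarrow>\<^sub>0 'a::field) \<Rightarrow> ('b \<Rightarrow>\<^sub>0 'a)" where
  "pm_restrict A = lin (\<lambda>b. if b \<in> A then Poly_Mapping.single b 1 else 0)"

lemma linear_pm_restrict: "Vector_Spaces.linear pscale pscale (pm_restrict A)"
  unfolding pm_restrict_def by (rule linear_lin)

lemma lookup_pm_restrict: "Poly_Mapping.lookup (pm_restrict A p) b = (if b \<in> A then Poly_Mapping.lookup p b else 0)"
proof -
  have "Poly_Mapping.lookup (pm_restrict A p) b =
      (\<Sum>c\<in>Poly_Mapping.keys p. if c = b then (if b \<in> A then Poly_Mapping.lookup p b else 0) else 0)"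
    unfolding pm_restrict_def lin_def lookup_sum
    by (intro sum.cong) (auto simp: lookup_single when_def)
  then show ?thesis by (simp add: in_keys_iff)
qed

text \<open>\<open>raise\<close> shifts the weight of every monomial by 2. Hence the weight
  components of an element of its kernel lie in the kernel as well.\<close>

lemma restrict_raise:
  "pm_restrict {M. weight n M = w + 2} (raise p) = raise (pm_restrict {M. weight n M = w} p)"
proof (rule linear_eqI[where f = "\<lambda>p. pm_restrict {M. weight n M = w + 2} (raise p)"])
  show "Vector_Spaces.linear pscale pscale (\<lambda>p. pm_restrict {M. weight n M = w + 2} (raise p))"
    "Vector_Spaces.linear pscale pscale (\<lambda>p. raise (pm_restrict {M. weight n M = w} p))"
    using Vector_Spaces.linear_compose[OF linear_raise linear_pm_restrict]
      Vector_Spaces.linear_compose[OF linear_pm_restrict linear_raise] by (simp_all add: o_def)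
next
  fix M :: "nat multiset"
  let ?s = "Poly_Mapping.single M (1::'a)"
  have "raise ?s \<in> vectors {M'. weight n M' = weight n M + 2}"
    unfolding raise_def
    by (rule shift_der_in_vectors[of _ "{M}"])
      (auto simp: weight_shift single_in_vectors simp del: weight_simps split: if_splits)
  then have "pm_restrict {M'. weight n M' = w + 2} (raise ?s) = (if weight n M = w then raise ?s else 0)"
    by (auto intro!: poly_mapping_eqI simp: lookup_pm_restrict in_vectors_iff)
  moreover have "pm_restrict {M. weight n M = w} ?s = (if weight n M = w then ?s else 0)"
    by (simp add: pm_restrict_def)
  ultimately show "pm_restrict {M. weight n M = w + 2} (raise ?s) = raise (pm_restrict {M. weight n M = w} ?s)"
    by (simp add: pm_pair.linear_0[OF linear_raise])
qed

text \<open>\<open>W\<close> is a set because both single weights and the half-lines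
  \<open>{-1..}\<close> and \<open>{1..}\<close> occur.\<close>

definition weight_monomials :: "nat \<Rightarrow> nat \<Rightarrow> int set \<Rightarrow> nat multiset set" where
  "weight_monomials n k W = {M \<in> multisets_of_size {0..n} k. weight n M \<in> W}"

lemma weight_monomials_iff:
  "M \<in> weight_monomials n k W \<longleftrightarrow> set_mset M \<subseteq> {0..n} \<and> size M = k \<and> weight n M \<in> W"
  by (auto simp: weight_monomials_def multisets_of_size_def)

lemma finite_weight_monomials [simp]: "finite (weight_monomials n k W)"
  by (simp add: weight_monomials_def finite_multisets_of_size)

lemma shift_weight_monomials:
  assumes "M \<in> weight_monomials n k W" "i \<in># M" "j \<le> n" "weight n M + 2 * int i - 2 * int j \<in> W'"
  shows "add_mset j (M - {#i#}) \<in> weight_monomials n k W'"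
  using assms by (auto simp: weight_monomials_iff algebra_simps dest!: multi_member_split)

lemma raise_weight_monomials:
  assumes "p \<in> vectors (weight_monomials n k W)"
  shows "raise p \<in> vectors (weight_monomials n k ((+) 2 ` W))"
  unfolding raise_def
proof (rule shift_der_in_vectors[OF assms])
  fix M i assume M: "M \<in> weight_monomials n k W" "i \<in># M" "(if i = 0 then 0 else 1) \<noteq> (0::'a)"
  then have "i \<le> n" "weight n M \<in> W" by (auto simp: weight_monomials_iff)
  with M show "add_mset (i - 1) (M - {#i#}) \<in> weight_monomials n k ((+) 2 ` W)"
    by (intro shift_weight_monomials[OF M(1,2)]) (auto split: if_splits)
qed

lemma lower_weight_monomials:
  assumes "p \<in> vectors (weight_monomials n k W)"
  shows "lower n p \<in> vectors (weight_monomials n k ((\<lambda>w. w - 2) ` W))"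
  unfolding lower_def
proof (rule shift_der_in_vectors[OF assms])
  fix M i assume M: "M \<in> weight_monomials n k W" "i \<in># M"
    "of_int ((int i + 1) * (int n - int i)) \<noteq> (0::'a)"
  then have "i \<le> n" "weight n M \<in> W" by (auto simp: weight_monomials_iff)
  \<comment> \<open>The coefficient contains the factor n - i, so the top index cannot occur
    here.\<close>
  moreover have "i \<noteq> n" using M(3) by auto
  ultimately show "add_mset (Suc i) (M - {#i#}) \<in> weight_monomials n k ((\<lambda>w. w - 2) ` W)"
    by (intro shift_weight_monomials[OF M(1,2)]) auto
qed

text \<open>The polynomials of degree \<open>k\<close> form the \<open>k\<close>-th symmetric power
  of the irreducible representation of dimension n + 1. Each of the \<open>k\<close> variables has
  weight between -n and n, whence the bound.\<close>

lemma sl2_weight_monomials: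
  "sl2_weight_spaces raise (lower n) (\<lambda>w. vectors (weight_monomials n k {w}) :: (_ \<Rightarrow>\<^sub>0 'a::field_char_0) set)
    (int (n * k))"
proof (rule sl2_weight_spaces.intro)
  fix w and p :: "nat multiset \<Rightarrow>\<^sub>0 'a" assume p: "p \<in> vectors (weight_monomials n k {w})"
  show "raise p \<in> vectors (weight_monomials n k {w + 2})"
    using raise_weight_monomials[OF p] by (simp add: add.commute)
  show "lower n p \<in> vectors (weight_monomials n k {w - 2})"
    using lower_weight_monomials[OF p] by simp
  have "lin (\<lambda>M. Poly_Mapping.single M (of_int (weight n M))) p = pscale (of_int w) p"
    by (rule linear_eqI[OF linear_lin pm.linear_scale_self])
      (use p in \<open>auto simp: vectors_def weight_monomials_iff\<close>)
  then show "raise (lower n p) - lower n (raise p) = pscale (of_int w) p"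
    by (simp add: raise_lower_commutator)
  show "p = 0" if "int (n * k) < \<bar>w\<bar>"
  proof -
    have "M \<notin> weight_monomials n k {w}" for M
      using weight_bound[of M n] that by (auto simp: weight_monomials_iff)
    then have "weight_monomials n k {w} = {}" by blast
    with p show ?thesis by (simp add: vectors_def)
  qed
qed (rule linear_raise linear_lower subspace_vectors)+

text \<open>All weights in degree \<open>k\<close> have the parity of \<open>n * k\<close>, so for
  each \<open>k\<close> at most one of the two summands is nonzero.\<close>

lemma dim_kernel_raise:
  "pm.dim {p \<in> vectors (multisets_of_size {0..n} k). raise p = (0 :: _ \<Rightarrow>\<^sub>0 'a::field_char_0)} =
    card (weight_monomials n k {0}) + card (weight_monomials n k {- 1})"
proof -
  interpret sl2_weight_spaces raise "lower n"
    "\<lambda>w. vectors (weight_monomials n k {w}) :: (_ \<Rightarrow>\<^sub>0 'a::field_char_0) set" "int (n * k)"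
    by (rule sl2_weight_monomials)
  \<comment> \<open>Weight -1 contains no nonzero kernel vector; it is included because
    \<open>raise\<close> maps it onto weight 1.\<close>
  let ?V = "vectors (weight_monomials n k {-1..}) :: (_ \<Rightarrow>\<^sub>0 'a) set"
  have ker: "{p \<in> vectors (multisets_of_size {0..n} k). raise p = 0} = {p \<in> ?V. raise p = 0}"
  proof (intro equalityI subsetI CollectI conjI)
    fix p :: "_ \<Rightarrow>\<^sub>0 'a" assume "p \<in> {p \<in> vectors (multisets_of_size {0..n} k). raise p = 0}"
    then have *: "raise p = 0" "p \<in> vectors (multisets_of_size {0..n} k)" by auto
    have "weight n M \<ge> -1" if "M \<in> Poly_Mapping.keys p" for M
    proof (rule ccontr)
      assume neg: "\<not> weight n M \<ge> -1"
      \<comment> \<open>The component of \<open>p\<close> in the weight of \<open>M\<close> is again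
        in the kernel, so it vanishes if that weight is negative.\<close>
      let ?q = "pm_restrict {M'. weight n M' = weight n M} p"
      have q: "?q \<in> vectors (weight_monomials n k {weight n M})"
        using *(2) by (auto simp: in_vectors_iff lookup_pm_restrict weight_monomials_def)
      have "raise ?q = 0"
        using restrict_raise[of n "weight n M" p] *(1) by (simp add: pm_pair.linear_0[OF linear_pm_restrict])
      moreover have "weight n M < 0" using neg by simp
      ultimately have "?q = 0" using e_inj[OF q] by blast
      then have "Poly_Mapping.lookup p M = 0"
        using lookup_pm_restrict[of "{M'. weight n M' = weight n M}" p M] by simp
      with that show False by (simp add: in_keys_iff)
    qed
    with *(2) show "p \<in> ?V" by (auto simp: vectors_def weight_monomials_def)
  qed (auto simp: vectors_def weight_monomials_def)
  have img: "raise ` ?V = vectors (weight_monomials n k {1..})"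
  proof
    show "raise ` ?V \<subseteq> vectors (weight_monomials n k {1..})"
    proof
      fix q :: "_ \<Rightarrow>\<^sub>0 'a" assume "q \<in> raise ` ?V"
      then have "q \<in> vectors (weight_monomials n k ((+) 2 ` {-1..}))"
        using raise_weight_monomials by blast
      then show "q \<in> vectors (weight_monomials n k {1..})"
        by (simp add: image_add_atLeast)
    qed
    \<comment> \<open>The image is a subspace, so it is enough to reach the monomials, each of which
      is a weight vector.\<close>
    have "Poly_Mapping.single M 1 \<in> raise ` ?V" if M: "M \<in> weight_monomials n k {1..}" for M
    proof -
      have "Poly_Mapping.single M (1::'a) \<in> vectors (weight_monomials n k {weight n M})"
        using M by (intro single_in_vectors) (auto simp: weight_monomials_iff)
      then obtain u where "u \<in> vectors (weight_monomials n k {weight n M - 2})" "raise u = Poly_Mapping.single M (1::'a)"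
        using e_surj[of _ "weight n M"] M by (auto simp: weight_monomials_iff)
      moreover have "weight_monomials n k {weight n M - 2} \<subseteq> weight_monomials n k {-1..}"
        using M by (auto simp: weight_monomials_iff)
      ultimately show ?thesis
        by (metis (no_types, lifting) imageI mem_Collect_eq subset_trans vectors_def)
    qed
    then show "vectors (weight_monomials n k {1..}) \<subseteq> raise ` ?V"
      unfolding vectors_eq_span[of "weight_monomials n k {1..}"]
      by (intro pm.span_minimal pm_pair.linear_subspace_image linear_raise subspace_vectors) auto
  qed
  have "pm.dim ?V = pm.dim {p \<in> ?V. raise p = 0} + pm.dim (raise ` ?V)"
    by (rule pm_pair.dim_kernel_image[OF linear_raise subspace_vectors finite_imageI[OF finite_weight_monomials]])
      (subst vectors_eq_span, rule order_refl)
  then have "card (weight_monomials n k {-1..}) =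
      pm.dim {p \<in> ?V. raise p = 0} + card (weight_monomials n k {1..})"
    unfolding img by (simp add: dim_vectors)
  moreover have "weight_monomials n k {-1..} =
      weight_monomials n k {0} \<union> weight_monomials n k {-1} \<union> weight_monomials n k {1..}"
    by (auto simp: weight_monomials_iff)
  moreover have "card \<dots> = card (weight_monomials n k {0}) + card (weight_monomials n k {- 1})
      + card (weight_monomials n k {1..})"
  proof -
    have "weight_monomials n k {0} \<inter> weight_monomials n k {-1} = {}"
      "(weight_monomials n k {0} \<union> weight_monomials n k {-1}) \<inter> weight_monomials n k {1..} = {}"
      by (auto simp: weight_monomials_iff)
    then show ?thesis by (simp add: card_Un_disjoint)
  qed
  ultimately show ?thesis unfolding ker by simp
qed

section \<open>Enveloping algebras by generators and relations\<close>

lemma list_zero_plus [simp]: "(0 :: 'b list) = []" "(u :: 'b list) + v = u @ v"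
  by (simp_all add: zero_list_def plus_list_def)

lemma single_Nil_one [simp]: "Poly_Mapping.single [] 1 = (1 :: 'b list \<Rightarrow>\<^sub>0 'a::zero_neq_one)"
  using single_one[where ?'a = "'b list"] by simp

lemma pscale_conv_mult_Nil: "pscale c p = Poly_Mapping.single [] c * (p :: 'b list \<Rightarrow>\<^sub>0 'a::field)"
  using pscale_conv_mult[of c p] by simp

lemma vectors_lists_mult:
  assumes "p \<in> vectors (lists A)" "q \<in> vectors (lists A)"
  shows "p * q \<in> vectors (lists A)"
proof (rule vectorsI)
  have "x @ y \<in> lists A" if "x \<in> Poly_Mapping.keys p" "y \<in> Poly_Mapping.keys q" for x y
    using that assms by (auto simp: vectors_def)
  then show "Poly_Mapping.keys (p * q) \<subseteq> lists A"
    using keys_mult[of p q] by fastforce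
qed

lemma one_in_vectors_lists [simp]: "1 \<in> vectors (lists A)"
  by (simp add: vectors_def)

lemma tensor_conv_lin: "tensor = lin (\<lambda>b. Poly_Mapping.single [b] 1)"
  by (simp add: fun_eq_iff tensor_def lin_def)

lemma tensor_algebra_simps [simp]:
  "carrier (tensor_algebra B) = vectors (lists B)" "mult (tensor_algebra B) = (*)"
  "one (tensor_algebra B) = 1" "zero (tensor_algebra B) = 0" "add (tensor_algebra B) = (+)"
  by (simp_all add: tensor_algebra_def vectors_def)

lemma ring_tensor_algebra: "ring (tensor_algebra B)"
proof (rule ringI)
  show "abelian_group (tensor_algebra B)"
  proof (rule abelian_groupI)
    show "\<exists>q\<in>carrier (tensor_algebra B). q \<oplus>\<^bsub>tensor_algebra B\<^esub> p = \<zero>\<^bsub>tensor_algebra B\<^esub>"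
      if "p \<in> carrier (tensor_algebra B)" for p
      using that pm.subspace_neg[OF subspace_vectors] by (intro bexI[of _ "- p"]) auto
  qed (auto intro: pm.subspace_add[OF subspace_vectors] pm.subspace_0[OF subspace_vectors])
  show "Group.monoid (tensor_algebra B)"
    by unfold_locales (auto simp: mult.assoc vectors_lists_mult)
qed (auto simp: distrib_left distrib_right)

lemma a_inv_tensor_algebra:
  "p \<in> vectors (lists B) \<Longrightarrow> \<ominus>\<^bsub>tensor_algebra B\<^esub> p = - p"
  using pm.subspace_neg[OF subspace_vectors, of p]
  by (intro abelian_group.minus_equality[OF ring.is_abelian_group[OF ring_tensor_algebra]]) auto

lemma pscale_in_ideal:
  assumes "ideal J (tensor_algebra B)" "p \<in> J"
  shows "pscale c p \<in> J"
  unfolding pscale_conv_mult_Nil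
  using ideal.I_l_closed[OF assms, of "Poly_Mapping.single [] c"] by (simp add: single_in_vectors)

text \<open>With this, \<open>linear_in_subspace\<close> applies to ideals, and membership of a
  linear expression can be checked word by word.\<close>

lemma subspace_ideal:
  assumes "ideal J (tensor_algebra B)"
  shows "pm.subspace J"
proof -
  interpret J: ideal J "tensor_algebra B" by fact
  show ?thesis
    using additive_subgroup.a_closed[OF J.additive_subgroup_axioms]
      additive_subgroup.zero_closed[OF J.additive_subgroup_axioms] pscale_in_ideal[OF assms]
    by (intro pm.subspaceI) simp_all
qed

text \<open>Dimensions in the quotient are taken over a subfield of the ring itself; it arises as
  the image of this copy of the base field.\<close>

lemma subfield_constants: "subfield (range (Poly_Mapping.single [])) (tensor_algebra B)"
proof -
  let ?K = "range (Poly_Mapping.single []) :: ('a list \<Rightarrow>\<^sub>0 'b) set"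
  interpret T: ring "tensor_algebra B" by (rule ring_tensor_algebra)
  have "subring ?K (tensor_algebra B)"
  proof (rule T.subringI)
    show "\<ominus>\<^bsub>tensor_algebra B\<^esub> h \<in> ?K" if "h \<in> ?K" for h
      using that by (auto simp: a_inv_tensor_algebra single_in_vectors simp flip: single_uminus)
  qed (auto simp: single_in_vectors mult_single simp flip: single_add single_Nil_one)
  then have sub: "subcring ?K (tensor_algebra B)"
    by (rule T.subcringI) (auto simp: mult_single mult.commute)
  show ?thesis
  proof (rule T.subfieldI[OF sub])
    have nz: "Poly_Mapping.single [] c \<noteq> (0 :: 'a list \<Rightarrow>\<^sub>0 'b)" if "c \<noteq> 0" for c
      using that inj_single[of "[] :: 'a list"] by (metis injD single_zero)
    have inverse: "\<exists>d. Poly_Mapping.single [] (d * c) = (1 :: 'a list \<Rightarrow>\<^sub>0 'b) \<and>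
        Poly_Mapping.single [] (c * d) = (1 :: 'a list \<Rightarrow>\<^sub>0 'b)" if "c \<noteq> 0" for c
      using that by (intro exI[of _ "1 / c"]) simp
    have "x \<in> Units (tensor_algebra B\<lparr>carrier := ?K\<rparr>) \<longleftrightarrow> x \<in> ?K - {0}" for x
    proof (cases "x \<in> ?K")
      case True
      then obtain c where x: "x = Poly_Mapping.single [] c" by auto
      show ?thesis
        by (cases "c = 0") (use inverse[of c] nz in \<open>auto simp: Units_def x mult_single\<close>)
    qed (auto simp: Units_def)
    then show "Units (tensor_algebra B\<lparr>carrier := ?K\<rparr>) = ?K - {\<zero>\<^bsub>tensor_algebra B\<^esub>}"
      by auto
  qed
qed

section \<open>The quotient of the tensor algebra by the enveloping ideal\<close>

locale structure_constants =
  fixes B :: "'b set" and br :: "'b \<Rightarrow> 'b \<Rightarrow> ('b \<Rightarrow>\<^sub>0 'a::field)"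
  assumes bracket_closed: "b \<in> B \<Longrightarrow> c \<in> B \<Longrightarrow> br b c \<in> vectors B"
begin

abbreviation "T \<equiv> tensor_algebra B :: ('b list \<Rightarrow>\<^sub>0 'a) ring"
abbreviation "I \<equiv> enveloping_ideal B br"
abbreviation "U \<equiv> enveloping_algebra B br"
abbreviation "cls \<equiv> enveloping_class B br"
abbreviation "K \<equiv> enveloping_scalars B br"

definition relation :: "'b \<Rightarrow> 'b \<Rightarrow> ('b list \<Rightarrow>\<^sub>0 'a)" where
  "relation b c = Poly_Mapping.single [b, c] 1 - Poly_Mapping.single [c, b] 1 - tensor (br b c)"

text \<open>Bilinearity in \<open>u\<close> and \<open>v\<close> reduces the generators for
  arbitrary vectors to those for pairs of basis elements.\<close>

lemma generator_eq_sum_relations: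
  "tensor u * tensor v - tensor v * tensor u - tensor (bilinear_extension br u v) =
    (\<Sum>b\<in>Poly_Mapping.keys u. \<Sum>c\<in>Poly_Mapping.keys v.
      pscale (Poly_Mapping.lookup u b * Poly_Mapping.lookup v c) (relation b c))"
proof -
  have "tensor u * tensor v =
      (\<Sum>b\<in>Poly_Mapping.keys u. \<Sum>c\<in>Poly_Mapping.keys v.
        pscale (Poly_Mapping.lookup u b * Poly_Mapping.lookup v c) (Poly_Mapping.single [b, c] 1))" for u v :: "'b \<Rightarrow>\<^sub>0 'a"
    by (simp add: tensor_def sum_product mult_single)
  note * = this
  have "tensor v * tensor u =
      (\<Sum>b\<in>Poly_Mapping.keys u. \<Sum>c\<in>Poly_Mapping.keys v.
        pscale (Poly_Mapping.lookup u b * Poly_Mapping.lookup v c) (Poly_Mapping.single [c, b] 1))"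
    unfolding * by (subst sum.swap) (simp add: mult.commute)
  moreover have "tensor (bilinear_extension br u v) =
      (\<Sum>b\<in>Poly_Mapping.keys u. \<Sum>c\<in>Poly_Mapping.keys v.
        pscale (Poly_Mapping.lookup u b * Poly_Mapping.lookup v c) (tensor (br b c)))"
    by (simp add: bilinear_extension_def tensor_conv_lin lin_sum lin_scale flip: pscale_def)
  ultimately show ?thesis
    by (simp add: * relation_def pm.scale_right_diff_distrib sum_subtractf)
qed

lemma single_in_carrier: "w \<in> lists B \<Longrightarrow> Poly_Mapping.single w c \<in> vectors (lists B)"
  by (rule single_in_vectors)

lemma tensor_in_carrier: "u \<in> vectors B \<Longrightarrow> tensor u \<in> vectors (lists B)"
  unfolding tensor_conv_lin
  by (rule linear_in_subspace[OF linear_lin subspace_vectors])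
    (auto simp: vectors_def)

lemma relation_in_carrier: "b \<in> B \<Longrightarrow> c \<in> B \<Longrightarrow> relation b c \<in> vectors (lists B)"
  unfolding relation_def
  by (intro pm.subspace_diff subspace_vectors tensor_in_carrier bracket_closed single_in_carrier) auto

lemma generators_in_carrier:
  "{tensor u * tensor v - tensor v * tensor u - tensor (bilinear_extension br u v) | u v.
        u \<in> vectors B \<and> v \<in> vectors B} \<subseteq> vectors (lists B)"
  unfolding generator_eq_sum_relations
  by (auto simp: vectors_def[of B] subset_iff
      intro!: pm.subspace_sum pm.subspace_scale subspace_vectors relation_in_carrier)

sublocale T: ring T
  by (rule ring_tensor_algebra)

sublocale I: ideal I T
  unfolding enveloping_ideal_def by (rule T.genideal_ideal) (simp add: generators_in_carrier)

lemma relation_in_ideal: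
  assumes "b \<in> B" "c \<in> B"
  shows "relation b c \<in> I"
proof -
  let ?u = "Poly_Mapping.single b (1::'a)" and ?v = "Poly_Mapping.single c (1::'a)"
  have "?u \<in> vectors B" "?v \<in> vectors B" using assms by (auto intro: single_in_vectors)
  then have "tensor ?u * tensor ?v - tensor ?v * tensor ?u - tensor (bilinear_extension br ?u ?v) \<in> I"
    unfolding enveloping_ideal_def
    using generators_in_carrier by (intro subsetD[OF T.genideal_self]) auto
  then show ?thesis
    unfolding generator_eq_sum_relations by simp
qed

text \<open>The relations of basis elements already generate \<open>I\<close>; this is how a module
  on which they vanish becomes a module over \<open>U\<close>.\<close>

lemma ideal_minimal:
  assumes "ideal J T" "\<And>b c. b \<in> B \<Longrightarrow> c \<in> B \<Longrightarrow> relation b c \<in> J"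
  shows "I \<subseteq> J"
  unfolding enveloping_ideal_def
proof (rule T.genideal_minimal[OF assms(1)])
  show "{tensor u * tensor v - tensor v * tensor u - tensor (bilinear_extension br u v) | u v.
        u \<in> vectors B \<and> v \<in> vectors B} \<subseteq> J"
    unfolding generator_eq_sum_relations using assms
    by (auto simp: vectors_def[of B] subset_iff
        intro!: pm.subspace_sum pm.subspace_scale subspace_ideal[OF assms(1)])
qed

lemmas subspace_I = subspace_ideal[OF I.ideal_axioms]

lemma ideal_mult_left: "p \<in> vectors (lists B) \<Longrightarrow> q \<in> I \<Longrightarrow> p * q \<in> I"
  using I.I_l_closed[of q p] by simp

lemma ideal_mult_right: "p \<in> vectors (lists B) \<Longrightarrow> q \<in> I \<Longrightarrow> q * p \<in> I"
  using I.I_r_closed[of q p] by simp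

sublocale U: ring U
  unfolding enveloping_algebra_def by (rule I.quotient_is_ring)

lemma cls_ring_hom: "ring_hom_ring T U cls"
  using I.rcos_ring_hom_ring by (simp add: enveloping_algebra_def enveloping_class_def[abs_def])

lemma carrier_U: "carrier U = cls ` vectors (lists B)"
  by (auto simp: enveloping_algebra_def FactRing_def A_RCOSETS_def' enveloping_class_def)

lemma cls_in_carrier [simp]: "p \<in> vectors (lists B) \<Longrightarrow> cls p \<in> carrier U"
  by (simp add: carrier_U)

lemma cls_hom:
  assumes "p \<in> vectors (lists B)" "q \<in> vectors (lists B)"
  shows "cls (p + q) = cls p \<oplus>\<^bsub>U\<^esub> cls q" "cls (p * q) = cls p \<otimes>\<^bsub>U\<^esub> cls q"
proof -
  interpret h: ring_hom_ring T U cls by (rule cls_ring_hom)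
  show "cls (p + q) = cls p \<oplus>\<^bsub>U\<^esub> cls q" "cls (p * q) = cls p \<otimes>\<^bsub>U\<^esub> cls q"
    using assms h.hom_add[of p q] h.hom_mult[of p q] by simp_all
qed

lemma cls_zero: "cls 0 = \<zero>\<^bsub>U\<^esub>" and cls_one: "cls 1 = \<one>\<^bsub>U\<^esub>"
proof -
  interpret h: ring_hom_ring T U cls by (rule cls_ring_hom)
  show "cls 0 = \<zero>\<^bsub>U\<^esub>" "cls 1 = \<one>\<^bsub>U\<^esub>"
    using h.hom_zero h.hom_one by simp_all
qed

lemma cls_eq_iff:
  assumes "p \<in> vectors (lists B)" "q \<in> vectors (lists B)"
  shows "cls p = cls q \<longleftrightarrow> p - q \<in> I"
proof -
  have "p \<oplus>\<^bsub>T\<^esub> \<ominus>\<^bsub>T\<^esub> q = p - q" using assms by (simp add: a_inv_tensor_algebra)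
  then have "p - q \<in> I \<longleftrightarrow> p \<in> I +>\<^bsub>T\<^esub> q"
    using I.a_rcos_module[of q p] assms by simp
  also have "\<dots> \<longleftrightarrow> cls p = cls q"
    unfolding enveloping_class_def
    using assms I.a_rcos_self[of p] T.a_repr_independence[OF _ _ I.a_subgroup, of p q] by auto
  finally show ?thesis ..
qed

text \<open>A homomorphic image of a field is a field as long as the target is not the zero ring,
  which is what \<open>1 \<notin> I\<close> excludes.\<close>

lemma subfield_scalars:
  assumes "1 \<notin> I"
  shows "subfield K U"
proof -
  interpret h: ring_hom_ring T U cls by (rule cls_ring_hom)
  have "\<one>\<^bsub>U\<^esub> \<noteq> \<zero>\<^bsub>U\<^esub>"
    using assms cls_eq_iff[of 1 0] by (simp add: cls_one cls_zero)
  from h.img_is_subfield(2)[OF subfield_constants this]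
  show ?thesis by (simp add: enveloping_scalars_def image_image)
qed

text \<open>Carries dimensions of \<open>pscale\<close> spaces over to the inductive
  \<open>dimension\<close> over a subfield. As \<open>f\<close> is injective modulo
  \<open>I\<close>, each further basis vector gives a proper line extension.\<close>

lemma dimension_image_span:
  fixes f :: "('m \<Rightarrow>\<^sub>0 'a) \<Rightarrow> ('b list \<Rightarrow>\<^sub>0 'a)"
  assumes f: "Vector_Spaces.linear pscale pscale f"
    and "\<And>p. p \<in> pm.span S \<Longrightarrow> f p \<in> vectors (lists B)"
    and "\<And>p. p \<in> pm.span S \<Longrightarrow> f p \<in> I \<Longrightarrow> p = 0"
    and "pm.independent S" "finite S"
  shows "U.dimension (card S) K ((\<lambda>p. cls (f p)) ` pm.span S)"
  using assms(5,2-4)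
proof (induction S rule: finite_induct)
  case empty
  then show ?case
    using U.zero_dim by (simp add: cls_zero pm_pair.linear_0[OF f])
next
  case (insert a S)
  let ?F = "\<lambda>p. cls (f p)"
  have sub: "pm.span S \<subseteq> pm.span (insert a S)" by (rule pm.span_mono) auto
  have a: "a \<in> pm.span (insert a S)" by (simp add: pm.span_base)
  have "a \<notin> pm.span S" "pm.independent S"
    using insert.prems(3) insert.hyps(2) by (auto simp: pm.independent_insert)
  have carrier: "f p \<in> vectors (lists B)" if "p \<in> pm.span (insert a S)" for p
    using insert.prems(1) that by blast
  have "?F a \<notin> ?F ` pm.span S"
  proof
    assume "?F a \<in> ?F ` pm.span S"
    then obtain p where p: "p \<in> pm.span S" "?F a = ?F p" by auto
    then have "f (a - p) \<in> I"
      using carrier a sub by (subst pm_pair.linear_diff[OF f], subst cls_eq_iff[symmetric]) auto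
    then have "a - p = 0"
      using insert.prems(2) a p sub pm.span_diff[of a _ p] by blast
    with p \<open>a \<notin> pm.span S\<close> show False by simp
  qed
  moreover have "U.dimension (card S) K (?F ` pm.span S)"
    using insert.prems sub \<open>pm.independent S\<close> by (intro insert.IH) auto
  ultimately have "U.dimension (Suc (card S)) K (U.line_extension K (?F a) (?F ` pm.span S))"
    using carrier[OF a] by (intro U.Suc_dim) auto
  also have "U.line_extension K (?F a) (?F ` pm.span S) = ?F ` pm.span (insert a S)"
  proof -
    \<comment> \<open>Scaling by \<open>c\<close> becomes multiplication by the class of a constant,
      the form in which line extensions are stated.\<close>
    have eq: "?F (pscale c a + p) = cls (Poly_Mapping.single [] c) \<otimes>\<^bsub>U\<^esub> ?F a \<oplus>\<^bsub>U\<^esub> ?F p"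
      if "p \<in> pm.span S" for c p
      using carrier[OF a] carrier[of p] that sub
      by (simp add: pm_pair.linear_add[OF f] pm_pair.linear_scale[OF f] pscale_conv_mult_Nil cls_hom
          single_in_vectors vectors_lists_mult subset_iff)
    show ?thesis
    proof (intro equalityI subsetI)
      fix z assume "z \<in> U.line_extension K (?F a) (?F ` pm.span S)"
      then obtain c p where "p \<in> pm.span S" "z = cls (Poly_Mapping.single [] c) \<otimes>\<^bsub>U\<^esub> ?F a \<oplus>\<^bsub>U\<^esub> ?F p"
        by (auto simp: U.line_extension_mem_iff enveloping_scalars_def)
      moreover from this have "pscale c a + p \<in> pm.span (insert a S)"
        using sub a by (intro pm.span_add pm.span_scale) auto
      ultimately show "z \<in> ?F ` pm.span (insert a S)" by (metis eq imageI)
    next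
      fix z assume "z \<in> ?F ` pm.span (insert a S)"
      then obtain q c where "z = ?F q" "q - pscale c a \<in> pm.span S"
        by (auto simp: pm.span_insert)
      with eq[OF this(2), of c] show "z \<in> U.line_extension K (?F a) (?F ` pm.span S)"
        by (auto simp: U.line_extension_mem_iff enveloping_scalars_def)
    qed
  qed
  finally show ?case using insert.hyps by simp
qed

end

section \<open>The center of the filiform enveloping algebra\<close>

fun gen_action :: "filiform_gen \<Rightarrow> (nat multiset \<Rightarrow>\<^sub>0 'a::field) \<Rightarrow> (nat multiset \<Rightarrow>\<^sub>0 'a)" where
  "gen_action Bx = raise"
| "gen_action (By i) = (*) (pvar i)"

text \<open>With \<open>foldr\<close> the last letter of a word acts first, so that concatenation
  becomes composition and the module is a left module.\<close>

definition action :: "(filiform_gen list \<Rightarrow>\<^sub>0 'a::field) \<Rightarrow> (nat multiset \<Rightarrow>\<^sub>0 'a) \<Rightarrow> (nat multiset \<Rightarrow>\<^sub>0 'a)" where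
  "action p q = lin (\<lambda>w. foldr gen_action w q) p"

lemma linear_mult_right:
  "Vector_Spaces.linear pscale pscale (\<lambda>p. p * (q :: 'b::monoid_add \<Rightarrow>\<^sub>0 'a::field))"
  by (rule linear_pscaleI) (simp_all add: distrib_right pscale_mult_left)

lemma linear_gen_action: "Vector_Spaces.linear pscale pscale (gen_action b)"
  by (cases b) (simp_all add: linear_raise linear_mult)

lemma linear_foldr_gen_action: "Vector_Spaces.linear pscale pscale (foldr gen_action w)"
proof (induction w)
  case Nil
  then show ?case by (simp add: pm.linear_id[unfolded id_def])
next
  case (Cons b w)
  from Vector_Spaces.linear_compose[OF this linear_gen_action, of b] show ?case by (simp add: o_def)
qed

lemma linear_action_left: "Vector_Spaces.linear pscale pscale (\<lambda>p. action p q)"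
  unfolding action_def by (rule linear_lin)

lemmas action_left_simps = pm_pair.linear_add[OF linear_action_left] pm_pair.linear_diff[OF linear_action_left]
  pm_pair.linear_scale[OF linear_action_left] pm_pair.linear_0[OF linear_action_left]

lemma linear_action_right: "Vector_Spaces.linear pscale pscale (action p)"
  unfolding action_def lin_def
  by (rule linear_pscaleI)
    (simp_all add: pm_pair.linear_add[OF linear_foldr_gen_action] pm_pair.linear_scale[OF linear_foldr_gen_action]
      pm.scale_right_distrib sum.distrib pm.scale_sum_right mult.commute)

lemma action_single: "action (Poly_Mapping.single w c) q = pscale c (foldr gen_action w q)"
  by (simp add: action_def)

lemma action_mult: "action (p * p') q = action p (action p' q)"
proof (rule linear_eqI[where f = "\<lambda>p. action (p * p') q"])
  from Vector_Spaces.linear_compose[OF linear_mult_right linear_action_left]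
  show "Vector_Spaces.linear pscale pscale (\<lambda>p. action (p * p') q)" by (simp add: o_def)
  fix w
  show "action (Poly_Mapping.single w 1 * p') q = action (Poly_Mapping.single w 1) (action p' q)"
  proof (rule linear_eqI[where f = "\<lambda>p'. action (Poly_Mapping.single w 1 * p') q"])
    show "Vector_Spaces.linear pscale pscale (\<lambda>p'. action (Poly_Mapping.single w 1 * p') q)"
      "Vector_Spaces.linear pscale pscale (\<lambda>p'. action (Poly_Mapping.single w 1) (action p' q))"
      using Vector_Spaces.linear_compose[OF linear_mult linear_action_left]
        Vector_Spaces.linear_compose[OF linear_action_left linear_action_right] by (simp_all add: o_def)
  qed (simp add: mult_single action_single)
qed (rule linear_action_left)

lemma action_one [simp]: "action 1 q = q"
  using action_single[of "[]" 1 q] by simp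

lemma tensor_single [simp]: "tensor (Poly_Mapping.single b c) = Poly_Mapping.single [b] c"
  by (simp add: tensor_conv_lin)

lemma tensor_zero [simp]: "tensor 0 = 0" and tensor_uminus: "tensor (- u) = - tensor u"
  by (simp_all add: tensor_conv_lin lin_uminus)

lemma structure_constants_filiform:
  "structure_constants (filiform_basis n) (filiform_bracket :: _ \<Rightarrow> _ \<Rightarrow> (_ \<Rightarrow>\<^sub>0 'a::field))"
proof
  fix b c assume "b \<in> filiform_basis n" "c \<in> filiform_basis n"
  then show "(filiform_bracket b c :: _ \<Rightarrow>\<^sub>0 'a) \<in> vectors (filiform_basis n)"
    by (cases "(b, c)" rule: filiform_bracket.cases)
      (auto simp: filiform_basis_def intro!: single_in_vectors pm.subspace_neg[OF subspace_vectors])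
qed

text \<open>The parameter \<open>dummy\<close> only serves to fix the field \<^typ>\<open>'a\<close>.\<close>

locale filiform =
  fixes n :: nat and dummy :: "'a::field itself"
begin

sublocale structure_constants "filiform_basis n" "filiform_bracket :: _ \<Rightarrow> _ \<Rightarrow> (_ \<Rightarrow>\<^sub>0 'a)"
  by (rule structure_constants_filiform)

text \<open>By the Leibniz rule the commutator of D with multiplication by y_i is multiplication by
  D y_i, and multiplications commute with each other.\<close>

lemma action_relation: "action (relation b c :: _ \<Rightarrow>\<^sub>0 'a) q = 0"
proof -
  have "action (relation Bx (By i) :: _ \<Rightarrow>\<^sub>0 'a) q = 0" "action (relation (By i) Bx :: _ \<Rightarrow>\<^sub>0 'a) q = 0" for i
    by (cases i; simp add: relation_def action_left_simps action_single raise_pvar_mult tensor_uminus)+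
  moreover have "action (relation (By i) (By j) :: _ \<Rightarrow>\<^sub>0 'a) q = 0" for i j
    by (simp add: relation_def action_left_simps action_single mult.left_commute)
  moreover have "action (relation Bx Bx :: _ \<Rightarrow>\<^sub>0 'a) q = 0"
    by (simp add: relation_def action_left_simps)
  ultimately show ?thesis by (cases b; cases c) simp_all
qed

lemma ideal_annihilator: "ideal {p \<in> vectors (lists (filiform_basis n)). \<forall>q. action p q = 0} T"
  (is "ideal ?J T")
proof (rule idealI[OF ring_tensor_algebra])
  show "subgroup ?J (add_monoid T)"
  proof (rule T.add.subgroupI)
    show "\<ominus>\<^bsub>T\<^esub> p \<in> ?J" if "p \<in> ?J" for p
      using that by (auto simp: a_inv_tensor_algebra pm_pair.linear_neg[OF linear_action_left]
          intro: pm.subspace_neg[OF subspace_vectors])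
  qed (auto simp: action_left_simps intro: exI[of _ 0] pm.subspace_add[OF subspace_vectors])
qed (auto simp: vectors_lists_mult action_mult pm_pair.linear_0[OF linear_action_right])

text \<open>The annihilator of the module is a two-sided ideal that contains the relations of basis
  elements, hence all of \<open>I\<close>.\<close>

lemma action_ideal: "p \<in> I \<Longrightarrow> action p q = 0"
  using ideal_minimal[OF ideal_annihilator] by (auto simp: relation_in_carrier action_relation)

lemma one_notin_ideal: "1 \<notin> I"
  using action_ideal[of 1 1] by auto

abbreviation "ys \<equiv> By ` {0..n}"

lemma lists_ys: "lists ys \<subseteq> lists (filiform_basis n)"
  by (rule lists_mono) (auto simp: filiform_basis_def)

lemma vectors_lists_ys: "p \<in> vectors (lists ys) \<Longrightarrow> p \<in> vectors (lists (filiform_basis n))"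
  using lists_ys by (auto simp: vectors_def)

section \<open>Normal forms of words in the commuting letters\<close>

lemma By_commute:
  assumes "b \<in> ys" "c \<in> ys"
  shows "Poly_Mapping.single [b, c] 1 - Poly_Mapping.single [c, b] 1 \<in> I"
proof -
  have "relation b c \<in> I" using assms by (intro relation_in_ideal) (auto simp: filiform_basis_def)
  moreover have "filiform_bracket b c = (0 :: _ \<Rightarrow>\<^sub>0 'a)" using assms by auto
  ultimately show ?thesis by (simp add: relation_def)
qed

lemma ideal_trans: "p - q \<in> I \<Longrightarrow> q - r \<in> I \<Longrightarrow> p - r \<in> I"
  using pm.subspace_add[OF subspace_I, of "p - q" "q - r"] by simp

lemma single_word_mult:
  "Poly_Mapping.single u 1 * Poly_Mapping.single v 1 = (Poly_Mapping.single (u @ v) 1 :: _ \<Rightarrow>\<^sub>0 'a)"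
  by (simp add: mult_single)

lemma move_letter:
  assumes "b \<in> ys" "u \<in> lists ys"
  shows "Poly_Mapping.single (u @ [b]) 1 - Poly_Mapping.single (b # u) 1 \<in> I"
  using assms(2)
proof (induction u)
  case Nil
  then show ?case by (simp add: pm.subspace_0[OF subspace_I])
next
  case (Cons a u)
  have a: "Poly_Mapping.single [a] (1::'a) \<in> vectors (lists (filiform_basis n))"
    "Poly_Mapping.single u (1::'a) \<in> vectors (lists (filiform_basis n))"
    using Cons.hyps lists_ys by (auto intro!: single_in_vectors simp: filiform_basis_def)
  \<comment> \<open>Modulo \<open>I\<close>, the word a u b equals a b u by induction, and this
    equals b a u by swapping the first two letters.\<close>
  have "Poly_Mapping.single [a] 1 * (Poly_Mapping.single (u @ [b]) 1 - Poly_Mapping.single (b # u) 1) \<in> I"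
    using Cons.IH a by (intro ideal_mult_left)
  moreover have "(Poly_Mapping.single [a, b] 1 - Poly_Mapping.single [b, a] 1) * Poly_Mapping.single u 1 \<in> I"
    using Cons.hyps assms(1) a by (intro ideal_mult_right By_commute)
  ultimately show ?case
    by (simp add: right_diff_distrib left_diff_distrib single_word_mult) (rule ideal_trans)
qed

lemma permuted_words:
  assumes "mset u = mset v" "u \<in> lists ys" "v \<in> lists ys"
  shows "Poly_Mapping.single u 1 - Poly_Mapping.single v 1 \<in> I"
  using assms
proof (induction u arbitrary: v)
  case Nil
  then show ?case by (simp add: pm.subspace_0[OF subspace_I])
next
  case (Cons b u)
  then have "b \<in> set v" by (metis list.set_intros(1) mset_eq_setD)
  then obtain r s where v: "v = r @ b # s" by (meson split_list)
  have words: "b \<in> ys" "u \<in> lists ys" "r \<in> lists ys" "s \<in> lists ys" using Cons.prems v by auto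
  then have "mset u = mset (r @ s)" "r @ s \<in> lists ys" using Cons.prems(1) v by auto
  \<comment> \<open>Modulo \<open>I\<close>, the word b u equals b r s by induction, and b r s
    equals r b s by \<open>move_letter\<close>.\<close>
  then have "Poly_Mapping.single [b] 1 * (Poly_Mapping.single u 1 - Poly_Mapping.single (r @ s) 1) \<in> I"
    using Cons.IH words by (intro ideal_mult_left single_in_vectors) (auto simp: filiform_basis_def)
  moreover have "(Poly_Mapping.single (r @ [b]) 1 - Poly_Mapping.single (b # r) 1) * Poly_Mapping.single s 1 \<in> I"
    using words lists_ys by (intro ideal_mult_right move_letter single_in_vectors) auto
  from pm.subspace_neg[OF subspace_I this]
  have "Poly_Mapping.single (b # r @ s) 1 - Poly_Mapping.single (r @ b # s) 1 \<in> I"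
    by (simp add: left_diff_distrib single_word_mult)
  ultimately show ?case
    unfolding v by (simp add: right_diff_distrib single_word_mult) (rule ideal_trans)
qed

text \<open>A linear section of the map \<open>\<lambda>p. action p 1\<close>, taking a monomial to
  the ordered word of a Poincare-Birkhoff-Witt basis.\<close>

definition sorted_words :: "(nat multiset \<Rightarrow>\<^sub>0 'a) \<Rightarrow> (filiform_gen list \<Rightarrow>\<^sub>0 'a)" where
  "sorted_words = lin (\<lambda>M. Poly_Mapping.single (map By (sorted_list_of_multiset M)) 1)"

lemma linear_sorted_words: "Vector_Spaces.linear pscale pscale sorted_words"
  unfolding sorted_words_def by (rule linear_lin)

lemma foldr_gen_action_By: "foldr gen_action (map By l) 1 = Poly_Mapping.single (mset l) (1::'a)"
  by (induction l) (simp_all add: pvar_mult_single flip: single_one)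

text \<open>Together with \<open>action_ideal\<close> this shows that distinct polynomials have
  distinct classes.\<close>

lemma action_sorted_words: "action (sorted_words q) 1 = q"
proof (rule linear_eqI[where f = "\<lambda>q. action (sorted_words q) 1" and g = "\<lambda>q. q"])
  show "Vector_Spaces.linear pscale pscale (\<lambda>q. action (sorted_words q) 1)"
    using Vector_Spaces.linear_compose[OF linear_sorted_words linear_action_left] by (simp add: o_def)
qed (simp_all add: pm.linear_id[unfolded id_def] sorted_words_def action_single foldr_gen_action_By)

definition y_words :: "nat \<Rightarrow> filiform_gen list set" where
  "y_words k = {w \<in> lists ys. length w = k}"

lemma y_word_cases:
  assumes "w \<in> lists ys"
  obtains l where "w = map By l" "set l \<subseteq> {0..n}"
proof -
  from assms have "\<exists>l. w = map By l \<and> set l \<subseteq> {0..n}"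
  proof (induction w)
    case (Cons b w)
    then obtain i l where "b = By i" "i \<le> n" "w = map By l" "set l \<subseteq> {0..n}" by auto
    then show ?case by (intro exI[of _ "i # l"]) auto
  qed simp
  then show thesis using that by blast
qed

lemma sorted_words_in_vectors:
  assumes "q \<in> vectors (multisets_of_size {0..n} k)"
  shows "sorted_words q \<in> vectors (y_words k)"
  by (rule linear_in_subspace[OF linear_sorted_words subspace_vectors])
    (use assms in \<open>auto simp: sorted_words_def vectors_def y_words_def multisets_of_size_def subset_iff
      simp flip: size_mset\<close>)

lemma action_in_vectors:
  assumes "(p :: _ \<Rightarrow>\<^sub>0 'a) \<in> vectors (y_words k)"
  shows "action p 1 \<in> vectors (multisets_of_size {0..n} k)"
proof (rule linear_in_subspace[OF linear_action_left subspace_vectors])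
  fix w assume "w \<in> Poly_Mapping.keys p"
  with assms have w: "w \<in> lists ys" "length w = k" by (auto simp: vectors_def y_words_def)
  then obtain l where "w = map By l" "set l \<subseteq> {0..n}" using y_word_cases by blast
  with w show "action (Poly_Mapping.single w (1::'a)) 1 \<in> vectors (multisets_of_size {0..n} k)"
    by (auto simp: action_single foldr_gen_action_By multisets_of_size_def intro!: single_in_vectors)
qed

lemma vectors_y_words: "p \<in> vectors (y_words k) \<Longrightarrow> p \<in> vectors (lists ys)"
  by (auto simp: vectors_def y_words_def)

text \<open>Every word is congruent to its sorted rearrangement. So the class of \<open>p\<close>
  depends only on the polynomial \<open>action p 1\<close>.\<close>

lemma normal_form:
  assumes "p \<in> vectors (lists ys)"
  shows "p - sorted_words (action p 1) \<in> I"
proof (rule linear_in_subspace[where f = "\<lambda>p. p - sorted_words (action p 1)"])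
  show "Vector_Spaces.linear pscale pscale (\<lambda>p. p - sorted_words (action p 1))"
    using Vector_Spaces.linear_compose[OF linear_action_left linear_sorted_words]
    by (intro pm_pair.linear_compose_sub) (simp_all add: o_def pm.linear_id[unfolded id_def])
  fix w assume "w \<in> Poly_Mapping.keys p"
  with assms have "w \<in> lists ys" by (auto simp: vectors_def)
  then obtain l where w: "w = map By l" "set l \<subseteq> {0..n}" by (rule y_word_cases)
  then have "Poly_Mapping.single w 1 - Poly_Mapping.single (map By (sorted_list_of_multiset (mset l))) 1 \<in> I"
    by (intro permuted_words) (auto simp: mset_map subset_iff)
  then show "Poly_Mapping.single w 1 - sorted_words (action (Poly_Mapping.single w 1) 1) \<in> I"
    by (simp add: w action_single foldr_gen_action_By sorted_words_def)
qed (rule subspace_I)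

section \<open>Commutators with letters and the criterion for central elements\<close>

lemma commutator_x_word:
  assumes "w \<in> lists ys"
  shows "\<exists>p\<in>vectors (lists ys).
    Poly_Mapping.single [Bx] 1 * Poly_Mapping.single w 1 - Poly_Mapping.single w 1 * Poly_Mapping.single [Bx] 1 - p \<in> I"
  using assms
proof (induction w)
  case Nil
  then show ?case by (intro bexI[of _ 0]) (simp_all add: pm.subspace_0[OF subspace_I])
next
  case (Cons a w)
  let ?x = "Poly_Mapping.single [Bx] (1::'a)" and ?a = "Poly_Mapping.single [a] (1::'a)"
    and ?w = "Poly_Mapping.single w (1::'a)"
  obtain p where p: "p \<in> vectors (lists ys)" "?x * ?w - ?w * ?x - p \<in> I"
    using Cons.IH by blast
  define t where "t = tensor (filiform_bracket Bx a :: _ \<Rightarrow>\<^sub>0 'a)"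
  have a: "?a \<in> vectors (lists ys)" and w: "?w \<in> vectors (lists ys)"
    using Cons.hyps by (auto intro!: single_in_vectors)
  have t: "t \<in> vectors (lists ys)"
    using Cons.hyps(1) by (cases "(Bx, a)" rule: filiform_bracket.cases) (auto simp: t_def intro!: single_in_vectors)
  have "relation Bx a \<in> I"
    using Cons.hyps(1) by (intro relation_in_ideal) (auto simp: filiform_basis_def)
  then have "?x * ?a - ?a * ?x - t \<in> I"
    by (simp add: relation_def t_def single_word_mult)
  \<comment> \<open>The Leibniz rule for the commutator with x: [x, a w] = [x, a] w + a
    [x, w].\<close>
  then have "(?x * ?a - ?a * ?x - t) * ?w + ?a * (?x * ?w - ?w * ?x - p) \<in> I"
    using p(2) a w by (intro pm.subspace_add subspace_I ideal_mult_left ideal_mult_right vectors_lists_ys)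
  moreover have "Poly_Mapping.single (a # w) 1 = ?a * ?w" by (simp add: single_word_mult)
  ultimately have "?x * Poly_Mapping.single (a # w) 1 - Poly_Mapping.single (a # w) 1 * ?x - (t * ?w + ?a * p) \<in> I"
    by (simp add: algebra_simps del: list_zero_plus)
  moreover have "t * ?w + ?a * p \<in> vectors (lists ys)"
    using a w t p(1) by (intro pm.subspace_add subspace_vectors vectors_lists_mult)
  ultimately show ?case by blast
qed

lemma raise_one [simp]: "raise 1 = 0"
  by (simp add: raise_def)

text \<open>By \<open>commutator_x_word\<close> the commutator is some polynomial in the y_i; acting
  on 1 identifies it, and \<open>normal_form\<close> sorts it.\<close>

lemma commutator_x:
  assumes "p \<in> vectors (lists ys)"
  shows "Poly_Mapping.single [Bx] 1 * p - p * Poly_Mapping.single [Bx] 1 - sorted_words (raise (action p 1)) \<in> I"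
    (is "?c p \<in> I")
proof (rule linear_in_subspace[where f = ?c])
  have "Vector_Spaces.linear pscale pscale (\<lambda>p. sorted_words (raise (action p 1)))"
    using Vector_Spaces.linear_compose[OF Vector_Spaces.linear_compose[OF linear_action_left linear_raise] linear_sorted_words]
    by (simp add: o_def)
  then show "Vector_Spaces.linear pscale pscale ?c"
    by (intro pm_pair.linear_compose_sub linear_mult linear_mult_right)
  fix w assume "w \<in> Poly_Mapping.keys p"
  with assms have "w \<in> lists ys" by (auto simp: vectors_def)
  let ?x = "Poly_Mapping.single [Bx] (1::'a)" and ?w = "Poly_Mapping.single w (1::'a)"
  obtain p' where p': "p' \<in> vectors (lists ys)" "?x * ?w - ?w * ?x - p' \<in> I"
    using commutator_x_word[OF \<open>w \<in> lists ys\<close>] by blast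
  \<comment> \<open>As \<open>raise 1 = 0\<close>, the term in which x acts first vanishes at
    1.\<close>
  have "action p' 1 = raise (action ?w 1)"
    using action_ideal[OF p'(2), of 1]
    by (simp only: action_left_simps action_mult)
      (simp add: action_single pm_pair.linear_0[OF linear_foldr_gen_action])
  then show "?c ?w \<in> I"
    using pm.subspace_add[OF subspace_I p'(2) normal_form[OF p'(1)]] by simp
qed (rule subspace_I)

lemma commute_letter:
  assumes "p \<in> vectors (lists ys)" "b \<in> ys"
  shows "Poly_Mapping.single [b] 1 * p - p * Poly_Mapping.single [b] 1 \<in> I" (is "?c p \<in> I")
proof (rule linear_in_subspace[where f = ?c])
  show "Vector_Spaces.linear pscale pscale ?c"
    by (intro pm_pair.linear_compose_sub linear_mult linear_mult_right)
  fix w assume "w \<in> Poly_Mapping.keys p"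
  with assms have "w \<in> lists ys" by (auto simp: vectors_def)
  from pm.subspace_neg[OF subspace_I move_letter[OF assms(2) this]] show "?c (Poly_Mapping.single w 1) \<in> I"
    by (simp add: single_word_mult)
qed (rule subspace_I)

text \<open>Letting the commutator with x act on 1 gives one direction. Conversely, commuting with
  all letters suffices: it passes to words by induction and to the whole algebra by
  linearity.\<close>

lemma central_iff:
  assumes "p \<in> vectors (lists ys)"
  shows "cls p \<in> ring_center U \<longleftrightarrow> raise (action p 1) = 0"
proof -
  let ?x = "Poly_Mapping.single [Bx] (1::'a)" and ?B = "filiform_basis n"
  have p: "p \<in> vectors (lists ?B)" using assms by (rule vectors_lists_ys)
  have x: "?x \<in> vectors (lists ?B)" by (rule single_in_vectors) (simp add: filiform_basis_def)
  have iff: "cls p \<otimes>\<^bsub>U\<^esub> cls q = cls q \<otimes>\<^bsub>U\<^esub> cls p \<longleftrightarrow> q * p - p * q \<in> I" if "q \<in> vectors (lists ?B)" for q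
    using p that by (subst eq_commute) (simp add: cls_eq_iff vectors_lists_mult flip: cls_hom)
  then have "cls p \<in> ring_center U \<longleftrightarrow> (\<forall>q\<in>vectors (lists ?B). q * p - p * q \<in> I)"
    using p by (auto simp: ring_center_def carrier_U)
  also have "\<dots> \<longleftrightarrow> raise (action p 1) = 0"
  proof
    assume "\<forall>q\<in>vectors (lists ?B). q * p - p * q \<in> I"
    then have "?x * p - p * ?x \<in> I" using x by blast
    from action_ideal[OF this, of 1] show "raise (action p 1) = 0"
      by (simp add: action_left_simps action_mult action_single pm_pair.linear_0[OF linear_action_right])
  next
    assume *: "raise (action p 1) = 0"
    have letter: "Poly_Mapping.single [b] 1 * p - p * Poly_Mapping.single [b] 1 \<in> I" if "b \<in> ?B" for b
    proof (cases "b = Bx")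
      case True
      then show ?thesis using commutator_x[OF assms] * by (simp add: pm_pair.linear_0[OF linear_sorted_words])
    next
      case False
      then show ?thesis using that by (intro commute_letter assms) (auto simp: filiform_basis_def)
    qed
    have word: "Poly_Mapping.single w 1 * p - p * Poly_Mapping.single w 1 \<in> I" if "w \<in> lists ?B" for w
      using that
    proof (induction w)
      case Nil
      then show ?case by (simp add: pm.subspace_0[OF subspace_I])
    next
      case (Cons b w)
      let ?b = "Poly_Mapping.single [b] (1::'a)" and ?w = "Poly_Mapping.single w (1::'a)"
      \<comment> \<open>The sum telescopes to the commutator of the word b w with
        \<open>p\<close>.\<close>
      have "?b * (?w * p - p * ?w) + (?b * p - p * ?b) * ?w \<in> I"
        using Cons letter
        by (intro pm.subspace_add subspace_I ideal_mult_left ideal_mult_right single_in_vectors) auto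
      moreover have "Poly_Mapping.single (b # w) 1 = ?b * ?w" by (simp add: single_word_mult)
      ultimately show ?case by (simp add: algebra_simps del: list_zero_plus)
    qed
    show "\<forall>q\<in>vectors (lists ?B). q * p - p * q \<in> I"
    proof
      fix q :: "_ \<Rightarrow>\<^sub>0 'a" assume q: "q \<in> vectors (lists ?B)"
      show "q * p - p * q \<in> I"
      proof (rule linear_in_subspace[where f = "\<lambda>q. q * p - p * q"])
        show "Vector_Spaces.linear pscale pscale (\<lambda>q. q * p - p * q)"
          by (intro pm_pair.linear_compose_sub linear_mult linear_mult_right)
        fix w assume "w \<in> Poly_Mapping.keys q"
        with q show "Poly_Mapping.single w 1 * p - p * Poly_Mapping.single w 1 \<in> I"
          unfolding vectors_def by (intro word) blast
      qed (rule subspace_I)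
    qed
  qed
  finally show ?thesis .
qed

section \<open>Graded components of the center and their dimensions\<close>

lemma y_polys_eq: "y_polys n k = (\<lambda>q. cls (sorted_words q)) ` vectors (multisets_of_size {0..n} k)"
proof -
  have "y_polys n k = cls ` vectors (y_words k)"
    by (simp add: y_polys_def vectors_def y_words_def)
  also have "\<dots> = (\<lambda>q. cls (sorted_words q)) ` vectors (multisets_of_size {0..n} k)"
  proof (intro equalityI image_subsetI)
    fix p :: "_ \<Rightarrow>\<^sub>0 'a" assume p: "p \<in> vectors (y_words k)"
    have "cls p = cls (sorted_words (action p 1))"
      using normal_form[OF vectors_y_words[OF p]] p
      by (subst cls_eq_iff) (auto intro!: vectors_lists_ys vectors_y_words sorted_words_in_vectors action_in_vectors)
    then show "cls p \<in> (\<lambda>q. cls (sorted_words q)) ` vectors (multisets_of_size {0..n} k)"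
      using action_in_vectors[OF p] by blast
  qed (use sorted_words_in_vectors in blast)
  finally show ?thesis .
qed

lemma center_component_eq:
  "center_component n k =
    (\<lambda>q. cls (sorted_words q)) ` {q \<in> vectors (multisets_of_size {0..n} k). raise q = 0}"
proof -
  have "cls (sorted_words q) \<in> ring_center U \<longleftrightarrow> raise q = 0"
    if "q \<in> vectors (multisets_of_size {0..n} k)" for q
    using central_iff[OF vectors_y_words[OF sorted_words_in_vectors[OF that]]]
    by (simp add: action_sorted_words)
  then show ?thesis by (auto simp: center_component_def y_polys_eq)
qed

text \<open>A polynomial is recovered from the class of its sorted words by acting on 1, so a basis
  of the kernel of \<open>raise\<close> is carried to a basis over the scalars.\<close>

lemma dim_center_component:
  "ring.dim U K (center_component n k) = pm.dim {q \<in> vectors (multisets_of_size {0..n} k). raise q = (0 :: _ \<Rightarrow>\<^sub>0 'a)}"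
proof -
  let ?Z = "{q \<in> vectors (multisets_of_size {0..n} k). raise q = (0 :: _ \<Rightarrow>\<^sub>0 'a)}"
  have subspace: "pm.subspace ?Z"
    using pm.subspace_inter[OF subspace_vectors pm_pair.linear_subspace_kernel[OF linear_raise]]
    by (simp add: Int_def)
  obtain S where S: "S \<subseteq> ?Z" "pm.independent S" "?Z \<subseteq> pm.span S" "card S = pm.dim ?Z"
    by (rule pm.basis_exists)
  have span: "pm.span S = ?Z"
    using S(1,3) pm.span_minimal[OF S(1) subspace] by blast
  have "finite (multisets_of_size {0..n} k)" by (rule finite_multisets_of_size) simp
  moreover have "S \<subseteq> pm.span ((\<lambda>M. Poly_Mapping.single M 1) ` multisets_of_size {0..n} k)"
    using S(1) by (auto simp flip: vectors_eq_span)
  ultimately have "finite S"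
    using pm.independent_span_bound[OF finite_imageI S(2)] by blast
  have "U.dimension (card S) K ((\<lambda>q. cls (sorted_words q)) ` pm.span S)"
  proof (rule dimension_image_span[OF linear_sorted_words _ _ S(2) \<open>finite S\<close>])
    show "sorted_words q \<in> vectors (lists (filiform_basis n))" if "q \<in> pm.span S" for q
      using that by (auto simp: span intro!: vectors_lists_ys vectors_y_words sorted_words_in_vectors)
    show "q = 0" if "sorted_words q \<in> I" for q
      using action_ideal[OF that, of 1] by (simp add: action_sorted_words)
  qed
  then have "U.dimension (pm.dim ?Z) K (center_component n k)"
    by (simp add: S(4) span center_component_eq)
  from U.dimI[OF subfield_scalars[OF one_notin_ideal] this] show ?thesis by (simp add: over_def)
qed

end

section \<open>The integral\<close>

lemma has_integral_exp_of_int: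
  "((\<lambda>\<phi>. exp (\<i> * of_int w * complex_of_real \<phi>)) has_integral
    (if w = 0 then 2 * complex_of_real pi else 0)) {- pi..pi}"
proof (cases "w = 0")
  case True
  have "((\<lambda>\<phi>::real. 1::complex) has_integral (pi - - pi) *\<^sub>R 1) {- pi..pi}"
    using has_integral_const_real[of "1::complex" "- pi" pi] by simp
  with True show ?thesis by (simp add: scaleR_conv_of_real)
next
  case False
  let ?F = "\<lambda>z::complex. exp (\<i> * of_int w * z) / (\<i> * of_int w)"
  have "((\<lambda>\<phi>. exp (\<i> * of_int w * complex_of_real \<phi>)) has_integral
      ?F (complex_of_real pi) - ?F (complex_of_real (- pi))) {- pi..pi}"
  proof (rule fundamental_theorem_of_calculus)
    fix x :: real
    have "(?F has_field_derivative exp (\<i> * of_int w * complex_of_real x)) (at (complex_of_real x))"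
      using False by (auto intro!: derivative_eq_intros)
    from has_vector_derivative_real_field[OF this]
    show "((\<lambda>x. ?F (complex_of_real x)) has_vector_derivative exp (\<i> * of_int w * complex_of_real x))
        (at x within {- pi..pi})" .
  qed simp
  \<comment> \<open>The two exponents differ by 2 pi i times the integer \<open>w\<close>.\<close>
  moreover have "exp (\<i> * of_int w * complex_of_real pi) = exp (\<i> * of_int w * complex_of_real (- pi))"
    unfolding exp_eq by (rule exI[of _ w]) (simp add: algebra_simps)
  ultimately show ?thesis using False by simp
qed

section \<open>Coefficients of the generating function of the weights\<close>

lemma inverse_one_minus_fps_X_const:
  "inverse (1 - fps_X * fps_const a) = Abs_fps (\<lambda>m. (a::'a::field) ^ m)"
proof (rule fps_inverse_unique)
  show "(1 - fps_X * fps_const a) * Abs_fps (\<lambda>m. a ^ m) = 1"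
  proof (rule fps_ext)
    fix m show "fps_nth ((1 - fps_X * fps_const a) * Abs_fps (\<lambda>m. a ^ m)) m = fps_nth 1 m"
      by (cases m) (simp_all add: left_diff_distrib mult.assoc)
  qed
qed

text \<open>Multiplying the geometric series gives the complete homogeneous symmetric polynomial of
  degree \<open>m\<close> in the \<open>a k\<close>.\<close>

lemma fps_nth_inverse_prod_linear:
  fixes a :: "'b \<Rightarrow> 'a::field"
  assumes "finite A"
  shows "fps_nth (inverse (\<Prod>k\<in>A. 1 - fps_X * fps_const (a k))) m =
    (\<Sum>X\<in>multisets_of_size A m. \<Prod>k\<in>#X. a k)"
proof -
  have "(\<Prod>k\<in>A. a k ^ count X k) = (\<Prod>k\<in>#X. a k)" if "X \<in> multisets_of_size A m" for X
    unfolding image_prod_mset_multiplicity using that assms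
    by (intro prod.mono_neutral_right) (auto simp: multisets_of_size_def not_in_iff)
  then show ?thesis
    by (simp add: inverse_prod_fps inverse_one_minus_fps_X_const fps_prod_nth'[OF assms])
qed

lemma prod_mset_exp: "(\<Prod>k\<in>#X. exp (f k)) = exp (\<Sum>k\<in>#X. f k :: 'a::{banach,real_normed_field})"
  by (induction X) (auto simp: exp_add)

lemma fps_nth_integrand:
  "fps_nth (fps_const c /
      (\<Prod>k=0..n. 1 - fps_X * fps_const (exp (\<i> * of_int (int n - 2 * int k) * complex_of_real \<phi>)))) m =
    (\<Sum>X\<in>multisets_of_size {0..n} m. c * exp (\<i> * of_int (weight n X) * complex_of_real \<phi>))"
proof -
  let ?P = "\<Prod>k=0..n. 1 - fps_X * fps_const (exp (\<i> * of_int (int n - 2 * int k) * complex_of_real \<phi>))"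
  \<comment> \<open>The constant term 1 makes the denominator a unit, so division is multiplication
    by the inverse series.\<close>
  have "fps_nth (\<Prod>k\<in>A. 1 - fps_X * fps_const (c k)) 0 = 1" for A :: "nat set" and c :: "nat \<Rightarrow> complex"
    by (induction A rule: infinite_finite_induct) simp_all
  then have "fps_nth ?P 0 \<noteq> 0" by simp
  have "(\<Sum>k\<in>#X. \<i> * of_int (int n - 2 * int k) * complex_of_real \<phi>) =
      \<i> * of_int (weight n X) * complex_of_real \<phi>" for X
    by (induction X) (simp_all add: algebra_simps)
  then show ?thesis
    unfolding fps_divide_unit[OF \<open>fps_nth ?P 0 \<noteq> 0\<close>]
    by (simp only: fps_nth_inverse_prod_linear[OF finite_atLeastAtMost] prod_mset_exp
        fps_mult_left_const_nth sum_distrib_left)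
qed

lemma integral_coefficient:
  "integral {- pi..pi} (\<lambda>\<phi>. fps_nth (fps_const (1 + exp (\<i> * complex_of_real \<phi>)) /
      (\<Prod>k=0..n. 1 - fps_X * fps_const (exp (\<i> * of_int (int n - 2 * int k) * complex_of_real \<phi>)))) m) =
    2 * complex_of_real pi * of_nat (card {X \<in> multisets_of_size {0..n} m. weight n X = 0} +
      card {X \<in> multisets_of_size {0..n} m. weight n X = - 1})"
proof -
  let ?M = "multisets_of_size {0..n} m"
  let ?\<delta> = "\<lambda>w::int. if w = 0 then 2 * complex_of_real pi else 0"
  have fin: "finite ?M" by (rule finite_multisets_of_size) simp
  \<comment> \<open>The factor splits a term of weight \<open>w\<close> into frequencies
    \<open>w\<close> and \<open>w + 1\<close>; integration keeps frequency 0, hence the weights 0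
    and -1.\<close>
  have "(1 + exp (\<i> * complex_of_real \<phi>)) * exp (\<i> * of_int w * complex_of_real \<phi>) =
      exp (\<i> * of_int w * complex_of_real \<phi>) + exp (\<i> * of_int (w + 1) * complex_of_real \<phi>)" for \<phi> w
    by (simp add: algebra_simps flip: exp_add)
  then have "((\<lambda>\<phi>. \<Sum>X\<in>?M. (1 + exp (\<i> * complex_of_real \<phi>)) * exp (\<i> * of_int (weight n X) * complex_of_real \<phi>))
      has_integral (\<Sum>X\<in>?M. ?\<delta> (weight n X) + ?\<delta> (weight n X + 1))) {- pi..pi}"
    by (simp only:) (intro has_integral_sum fin has_integral_add has_integral_exp_of_int)
  moreover have "(\<Sum>X\<in>?M. ?\<delta> (weight n X) + ?\<delta> (weight n X + 1)) =
      2 * complex_of_real pi * of_nat (card {X \<in> ?M. weight n X = 0} + card {X \<in> ?M. weight n X = - 1})"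
  proof -
    have "(\<Sum>X\<in>?M. ?\<delta> (weight n X + c)) = 2 * complex_of_real pi * of_nat (card {X \<in> ?M. weight n X = - c})" for c
    proof -
      have "{X \<in> ?M. weight n X + c = 0} = {X \<in> ?M. weight n X = - c}" by auto
      then show ?thesis using fin by (simp add: sum.If_cases Int_def)
    qed
    from this[of 0] this[of 1] show ?thesis by (simp add: sum.distrib distrib_left)
  qed
  ultimately show ?thesis
    by (simp only: fps_nth_integrand integral_unique)
qed

theorem theorem1p3:
  fixes n :: nat
  assumes "n \<ge> 1"
  shows "hilbert_series_center TYPE('a::field_char_0) n =
    fps_const (1 / (2 * complex_of_real pi)) *
    fps_coeff_integral (- pi) pi (\<lambda>\<phi>.
      fps_const (1 + exp (\<i> * complex_of_real \<phi>)) /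
      (\<Prod>k=0..n. 1 - fps_X * fps_const (exp (\<i> * of_int (int n - 2 * int k) * complex_of_real \<phi>))))"
proof (rule fps_ext)
  fix m
  have "fps_nth (hilbert_series_center TYPE('a) n) m =
      of_nat (card (weight_monomials n m {0}) + card (weight_monomials n m {- 1}))"
    by (simp only: hilbert_series_center_def fps_nth_Abs_fps filiform.dim_center_component dim_kernel_raise)
  then show "fps_nth (hilbert_series_center TYPE('a) n) m =
      fps_nth (fps_const (1 / (2 * complex_of_real pi)) *
        fps_coeff_integral (- pi) pi (\<lambda>\<phi>.
          fps_const (1 + exp (\<i> * complex_of_real \<phi>)) /
          (\<Prod>k=0..n. 1 - fps_X * fps_const (exp (\<i> * of_int (int n - 2 * int k) * complex_of_real \<phi>))))) m"
    by (simp only: fps_coeff_integral_def fps_mult_left_const_nth fps_nth_Abs_fps integral_coefficient)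
      (simp add: weight_monomials_def)
qed

end
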